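(* Let $\mathcal T=(T,\rho)$ be a rooted tree with arboreal singularity $\mathsf L_T$ and smoothed arboreal hypersurface $\mathsf H_{\mathcal T}=\bigcup_{\alpha\in V(T)}\mathsf H_\alpha\subset\mathbb R^{\mathcal T}$. (1) $\mathsf H_{\mathcal T}$ admits a coorientation $\sigma$ whose restriction to each $\mathsf H_\alpha$ (i.e. to $\mathcal L^*_{\mathsf H_\alpha}\subset\mathcal L^*_{\mathsf H_{\mathcal T}}$) is the coorientation $\sigma_\alpha$. (2) There is a homeomorphism $\varphi:\mathsf L_T\to\mathcal L^*_{\mathsf H_{\mathcal T}}$ onto the coline bundle of $\mathsf H_{\mathcal T}$ such that, writing $\pi:\mathcal L^*_{\mathsf H_{\mathcal T}}\to\mathsf H_{\mathcal T}$ for the natural projection, $\pi\circ\varphi$ restricts to a homeomorphism $\mathsf L_T(\alpha)\to\mathsf H_\alpha$ for every $\alpha\in V(T)$.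
   Context: Trees: a tree is a nonempty finite connected acyclic graph with vertex set $V(T)$ and edge set $E(T)$ (two-element subsets of $V(T)$). Arboreal singularity: for $\alpha\in V(T)$ let $\mathsf L_T(\alpha)=\mathbb R^{V(T)\setminus\{\alpha\}}$ with coordinates $x_\gamma(\alpha)$; $\mathsf L_T$ is the quotient of $\coprod_\alpha\mathsf L_T(\alpha)$ by the equivalence relation generated by identifying, for each edge $\{\alpha,\beta\}$, $\{x_\gamma(\alpha)\}\sim\{x_\gamma(\beta)\}$ whenever $x_\beta(\alpha)=x_\alpha(\beta)\ge0$ and $x_\gamma(\alpha)=x_\gamma(\beta)$ for $\gamma\ne\alpha,\beta$; $\mathsf L_T(\alpha)$ is regarded as a subspace of $\mathsf L_T$. Rooted tree $\mathcal T=(T,\rho)$: a tree with a chosen root vertex $\rho$. Partial order on $V(T)$: $\alpha\le\beta$ iff $\alpha$ lies on the unique minimal path from $\rho$ to $\beta$. Each $\alpha\ne\rho$ has a parent $\hat\alpha$: the vertex adjacent to $\alpha$ with $\hat\alpha<\alpha$. $\mathbb R^{\mathcal T}=\mathbb R^{V(T)}$ with coordinates $x_\gamma$. Smoothed hypersurface: fix a $C^1$ function $b:\mathbb R_{>0}\to\mathbb R$ with $b\le0$, $\lim_{t\to0}b(t)=0$, $\lim_{t\to0}b'(t)=-\infty$, and $b(t)=0$ for $t\gg0$; fix a $C^1$ submersion $f:\mathbb R^2\to\mathbb R$ with $\{f=0\}=\{x_1=0,x_2\ge0\}\cup\{x_1>0,x_2=b(x_1)\}$, $\{f>0\}=\{x_1>0,x_2>b(x_1)\}$,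 $\{f<0\}=\{x_1<0\}\cup\{x_1=0,x_2<0\}\cup\{x_1>0,x_2<b(x_1)\}$. Define $h_\rho=x_\rho$ and inductively $h_\alpha=f(h_{\hat\alpha},x_\alpha)$ for $\alpha\ne\rho$. Set $\mathsf Q_\alpha=\{h_\alpha\ge0\}$, $\mathsf H_\alpha=\{h_\alpha=0\}$, $\mathsf H_{\mathcal T}=\bigcup_\alpha\mathsf H_\alpha$. Microlocal notions: for a manifold $M$, $P^*M$ (resp. $S^*M$) is the bundle of lines (resp. rays) in $T^*M$ through nonzero covectors. A hypersurface $H\subset M$ is a closed subspace which is the closure of the top-dimensional stratum of a Whitney stratification, with open dense smooth locus $H^{sm}$. It is in good position if the closure $\mathcal L^*_H=\overline{P^*_{H^{sm}}M}\subset P^*M$ (the coline bundle) is finite over $H$; then also the coray bundle $\mathcal R^*_H=\overline{S^*_{H^{sm}}M}\subset S^*M$ is finite over $H$, and there is a natural two-fold cover $\mathcal R^*_H\to\mathcal L^*_H$. A coorientation of $H$ is a section $\sigma$ of $\mathcal R^*_H\to\mathcal L^*_H$. Each $\mathsf H_\alpha$ is a smooth hypersurface (since $h_\alpha$ is a submersion), hence $\mathsf H_{\mathcal T}$ is in good position; $\sigma_\alpha$ denotes the coorientation of $\mathsf H_\alpha$ given by the codirection pointing towards $\mathsf Q_\alpha$ (the ray of $dh_\alpha$). *)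

theory Defs
  imports "HOL-Analysis.Analysis"
begin

text \<open>A graph on the finite vertex type 'v (vertex set = UNIV) is given by a set E of
  edges, each a two-element subset of the vertex set.\<close>

definition is_walk :: "'v set set \<Rightarrow> 'v list \<Rightarrow> bool" where
  "is_walk E ps \<longleftrightarrow> ps \<noteq> [] \<and> (\<forall>i. Suc i < length ps \<longrightarrow> {ps ! i, ps ! Suc i} \<in> E)"

definition is_path :: "'v set set \<Rightarrow> 'v \<Rightarrow> 'v \<Rightarrow> 'v list \<Rightarrow> bool" where
  "is_path E a b ps \<longleftrightarrow> is_walk E ps \<and> distinct ps \<and> hd ps = a \<and> last ps = b"

definition is_cycle :: "'v set set \<Rightarrow> 'v list \<Rightarrow> bool" where
  "is_cycle E ps \<longleftrightarrow> is_walk E ps \<and> distinct ps \<and> length ps \<ge> 3 \<and> {last ps, hd ps} \<in> E"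

definition is_tree :: "('v::finite) set set \<Rightarrow> bool" where
  "is_tree E \<longleftrightarrow> (\<forall>e\<in>E. card e = 2)
     \<and> (\<forall>a b. \<exists>ps. is_walk E ps \<and> hd ps = a \<and> last ps = b)
     \<and> (\<nexists>ps. is_cycle E ps)"

definition tree_le :: "'v set set \<Rightarrow> 'v \<Rightarrow> 'v \<Rightarrow> 'v \<Rightarrow> bool" where
  "tree_le E \<rho> a b \<longleftrightarrow> (\<exists>ps. is_path E \<rho> b ps \<and> a \<in> set ps)"

definition is_parent :: "'v set set \<Rightarrow> 'v \<Rightarrow> 'v \<Rightarrow> 'v \<Rightarrow> bool" where
  "is_parent E \<rho> p a \<longleftrightarrow> {p, a} \<in> E \<and> tree_le E \<rho> p a \<and> p \<noteq> a"

definition quotient_topology :: "'a topology \<Rightarrow> ('a \<Rightarrow> 'b) \<Rightarrow> 'b topology" where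
  "quotient_topology X q =
     topology (\<lambda>U. U \<subseteq> q ` topspace X \<and> openin X {p \<in> topspace X. q p \<in> U})"

text \<open>The copy L_T(\<alpha>) = R^(V - {\<alpha>}) is modelled as {x :: real^'v. x$\<alpha> = 0} with the
  coordinate x$\<gamma> playing the role of x_\<gamma>(\<alpha>).\<close>

definition arb_copy :: "'v::finite \<Rightarrow> (real^'v) set" where
  "arb_copy \<alpha> = {x. x $ \<alpha> = 0}"

definition arb_rel :: "'v::finite set set \<Rightarrow> ('v \<times> (real^'v)) \<Rightarrow> ('v \<times> (real^'v)) \<Rightarrow> bool" where
  "arb_rel E p q \<longleftrightarrow> (case p of (\<alpha>, x) \<Rightarrow> case q of (\<beta>, y) \<Rightarrow>
      {\<alpha>, \<beta>} \<in> E \<and> x \<in> arb_copy \<alpha> \<and> y \<in> arb_copy \<beta> \<and>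
      x $ \<beta> = y $ \<alpha> \<and> x $ \<beta> \<ge> 0 \<and> (\<forall>\<gamma>. \<gamma> \<noteq> \<alpha> \<and> \<gamma> \<noteq> \<beta> \<longrightarrow> x $ \<gamma> = y $ \<gamma>))"

definition arb_class :: "'v::finite set set \<Rightarrow> ('v \<times> (real^'v)) \<Rightarrow> ('v \<times> (real^'v)) set" where
  "arb_class E p = {q. (sup (arb_rel E) (arb_rel E)\<inverse>\<inverse>)\<^sup>*\<^sup>* p q}"

definition arb_disjoint_union :: "('v::finite \<times> (real^'v)) topology" where
  "arb_disjoint_union = sum_topology (\<lambda>\<alpha>. top_of_set (arb_copy \<alpha>)) UNIV"

definition arboreal :: "'v::finite set set \<Rightarrow> ('v \<times> (real^'v)) set topology" where
  "arboreal E = quotient_topology arb_disjoint_union (arb_class E)"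

definition arboreal_piece :: "'v::finite set set \<Rightarrow> 'v \<Rightarrow> ('v \<times> (real^'v)) set set" where
  "arboreal_piece E \<alpha> = arb_class E ` ({\<alpha>} \<times> arb_copy \<alpha>)"

text \<open>Covectors at a point of R^V are identified with their coefficient vectors
  \<xi> = (\<xi>_\<gamma>) w.r.t. the dual basis dx_\<gamma>, i.e. with real^'v; T^*M = M \<times> real^'v.\<close>

definition line_of :: "'a::real_vector \<Rightarrow> 'a set" where
  "line_of \<xi> = range (\<lambda>c::real. c *\<^sub>R \<xi>)"

definition ray_of :: "'a::real_vector \<Rightarrow> 'a set" where
  "ray_of \<xi> = {c *\<^sub>R \<xi> | c::real. c > 0}"

definition ray_line :: "'a::real_vector set \<Rightarrow> 'a set" where
  "ray_line r = r \<union> uminus ` r \<union> {0}"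

definition nonzero_cotangent :: "('a::real_normed_vector \<times> 'a) topology" where
  "nonzero_cotangent = top_of_set {(x, \<xi>). \<xi> \<noteq> 0}"

definition PstarM :: "('a::real_normed_vector \<times> 'a set) topology" where
  "PstarM = quotient_topology nonzero_cotangent (\<lambda>(x, \<xi>). (x, line_of \<xi>))"

definition SstarM :: "('a::real_normed_vector \<times> 'a set) topology" where
  "SstarM = quotient_topology nonzero_cotangent (\<lambda>(x, \<xi>). (x, ray_of \<xi>))"

definition ray_to_line :: "('a::real_vector \<times> 'a set) \<Rightarrow> ('a \<times> 'a set)" where
  "ray_to_line p = (fst p, ray_line (snd p))"

definition local_defining :: "('a::euclidean_space) set \<Rightarrow> 'a \<Rightarrow> 'a set \<Rightarrow> ('a \<Rightarrow> real) \<Rightarrow> ('a \<Rightarrow> 'a) \<Rightarrow> bool" where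
  "local_defining H x U g G \<longleftrightarrow> open U \<and> x \<in> U \<and> continuous_on U G \<and>
     (\<forall>y\<in>U. (g has_derivative (\<lambda>v. G y \<bullet> v)) (at y) \<and> G y \<noteq> 0) \<and>
     H \<inter> U = {y \<in> U. g y = 0}"

definition smooth_locus :: "('a::euclidean_space) set \<Rightarrow> 'a set" where
  "smooth_locus H = {x \<in> H. \<exists>U g G. local_defining H x U g G}"

definition conormal :: "('a::euclidean_space) set \<Rightarrow> 'a \<Rightarrow> 'a \<Rightarrow> bool" where
  "conormal H x \<xi> \<longleftrightarrow> x \<in> H \<and> \<xi> \<noteq> 0 \<and> (\<exists>U g G c. local_defining H x U g G \<and> \<xi> = c *\<^sub>R G x)"

definition conormal_lines :: "('a::euclidean_space) set \<Rightarrow> ('a \<times> 'a set) set" where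
  "conormal_lines H = {(x, line_of \<xi>) | x \<xi>. conormal H x \<xi>}"

definition conormal_rays :: "('a::euclidean_space) set \<Rightarrow> ('a \<times> 'a set) set" where
  "conormal_rays H = {(x, ray_of \<xi>) | x \<xi>. conormal H x \<xi>}"

definition coline_bundle :: "('a::euclidean_space) set \<Rightarrow> ('a \<times> 'a set) set" where
  "coline_bundle H = PstarM closure_of conormal_lines H"

definition coray_bundle :: "('a::euclidean_space) set \<Rightarrow> ('a \<times> 'a set) set" where
  "coray_bundle H = SstarM closure_of conormal_rays H"

definition coorientation :: "('a::euclidean_space) set \<Rightarrow> ('a \<times> 'a set \<Rightarrow> 'a \<times> 'a set) \<Rightarrow> bool" where
  "coorientation H \<sigma> \<longleftrightarrow>
     continuous_map (subtopology PstarM (coline_bundle H)) (subtopology SstarM (coray_bundle H)) \<sigma>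
     \<and> (\<forall>p \<in> coline_bundle H. ray_to_line (\<sigma> p) = p)"

end

theory Submission
  imports Defs
begin

text \<open>Label the coordinates of a copy \<open>L_T(\<alpha>)\<close> by edges instead of vertices: \<open>x_\<gamma>(\<alpha>)\<close> belongs to
  the first edge on the path from \<open>\<gamma>\<close> to \<open>\<alpha>\<close>. Every copy becomes \<open>\<real>^E\<close>, and \<open>(\<alpha>, y) \<sim> (\<beta>, y)\<close> holds
  iff \<open>\<alpha>\<close> and \<open>\<beta>\<close> lie in the same component of the forest obtained by deleting the edges with
  \<open>y_e < 0\<close>; a component is determined by its vertex closest to \<open>\<rho>\<close>.

  On the other side, put \<open>s_\<rho> = x_\<rho>\<close> and \<open>s_\<alpha> = x_\<alpha> - b(h_p)\<close>, where \<open>p\<close> is the parent of \<open>\<alpha>\<close> and \<open>b\<close> is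
  extended by \<open>0\<close>. Then \<open>h_\<alpha>\<close> has the sign of \<open>m_\<alpha> = min {s_\<gamma> | \<gamma> \<le> \<alpha>}\<close>. In the coordinates
  \<open>x_\<rho>\<close> and \<open>y_\<alpha> = s_\<alpha> - m_p\<close> the hypersurface \<open>{h_\<alpha> = 0}\<close> is the graph of the function
  \<open>N_\<alpha>(y)\<close>, the sum of the negative parts of the \<open>y_\<gamma>\<close> along the path from \<open>\<rho>\<close> to \<open>\<alpha>\<close>. On it the ray of
  \<open>dh_\<alpha>\<close> is that of \<open>dh_\<tau>\<close>, where \<open>\<tau>\<close> is the top vertex of the component of \<open>\<alpha>\<close>, and distinct tops give
  distinct lines since the \<open>dx_\<tau>\<close> component of \<open>dh_\<tau>\<close> is positive.\<close>

section \<open>Rooted trees and the arboreal singularity\<close>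

lemma is_walk_iff_successively:
  "is_walk E ps \<longleftrightarrow> ps \<noteq> [] \<and> successively (\<lambda>x y. {x, y} \<in> E) ps"
  by (auto simp: is_walk_def successively_conv_nth)

text \<open>Two distinct paths with the same ends would close up to a cycle. A common first step is
  removed by induction; otherwise the cycle follows the first path up to a vertex \<open>c\<close>
  of the second one and returns along the second.\<close>

lemma path_unique:
  assumes "\<nexists>ps. is_cycle E ps" "is_path E a b ps" "is_path E a b qs"
  shows "ps = qs"
  using assms(2,3)
proof (induction ps arbitrary: a qs)
  case Nil
  then show ?case by (simp add: is_path_def is_walk_def)
next
  case (Cons a' ps)
  let ?S = "successively (\<lambda>x y. {x, y} \<in> E)"
  obtain qs' where qs: "qs = a # qs'" and a': "a' = a"
    using Cons.prems by (cases qs) (auto simp: is_path_def is_walk_def)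
  consider "ps = []" | "qs' = []" | "ps \<noteq> []" "qs' \<noteq> []" by blast
  then show ?case
  proof cases
    case 1
    then show ?thesis using Cons.prems qs a' by (auto simp: is_path_def split: if_splits)
  next
    case 2
    then show ?thesis using Cons.prems qs a' by (auto simp: is_path_def split: if_splits)
  next
    case 3
    have p: "?S ps" "{a, hd ps} \<in> E" "a \<notin> set ps" "distinct ps" "last ps = b"
      and q: "?S qs'" "{a, hd qs'} \<in> E" "a \<notin> set qs'" "distinct qs'" "last qs' = b"
      using Cons.prems qs a' 3 by (auto simp: is_path_def is_walk_iff_successively successively_Cons)
    show ?thesis
    proof (cases "hd ps = hd qs'")
      case True
      have "ps = qs'"
        by (rule Cons.IH[of "hd ps"])
          (use p q 3 True in \<open>auto simp: is_path_def is_walk_iff_successively\<close>)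
      then show ?thesis by (simp add: qs a')
    next
      case False
      have "last qs' \<in> set ps" "last qs' \<in> set qs'"
        using p(5) q(5) last_in_set[of ps] last_in_set[of qs'] 3 by auto
      \<comment> \<open>Taking the first vertex of \<open>qs'\<close> that lies on \<open>ps\<close>
        keeps \<open>q1\<close> disjoint from \<open>ps\<close>, so the closed walk repeats no
        vertex.\<close>
      then obtain q1 c q2 where q': "qs' = q1 @ c # q2" "c \<in> set ps" "\<forall>x\<in>set q1. x \<notin> set ps"
        using split_list_first_propE[of qs' "\<lambda>x. x \<in> set ps"] by blast
      obtain p1 p2 where p': "ps = p1 @ c # p2" using split_list[OF q'(2)] by blast
      let ?c = "a # p1 @ [c] @ rev q1"
      have sq1: "?S (q1 @ [c])" using q(1) q'(1) by (simp add: successively_append_iff)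
      then have srev: "?S ([c] @ rev q1)"
        using successively_rev[of "\<lambda>x y. {x, y} \<in> E" "q1 @ [c]"] by (simp add: insert_commute)
      have sp1: "?S (p1 @ [c])" using p(1) p' by (simp add: successively_append_iff)
      have "hd (p1 @ [c]) = hd ps" using p' by (cases p1) auto
      then have "?S ?c" using srev sp1 p(2)
        by (auto simp: successively_append_iff successively_Cons hd_append)
      moreover have "distinct ?c" using p q q' p' by auto
      \<comment> \<open>If \<open>p1\<close> and \<open>q1\<close> were both empty, \<open>c\<close>
        would be the second vertex of both paths.\<close>
      moreover have "length ?c \<ge> 3"
        using False q' p' by (cases p1; cases q1) auto
      moreover have "last ?c = hd qs'" using q' by (cases q1) auto
      then have "{last ?c, hd ?c} \<in> E" using q(2) by (simp add: insert_commute)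
      ultimately have "is_cycle E ?c" by (simp add: is_cycle_def is_walk_iff_successively)
      then show ?thesis using assms(1) by blast
    qed
  qed
qed

text \<open>Loop erasure: if the new first vertex already lies on the path found for the tail,
  everything before it on that path is dropped.\<close>

lemma walk_imp_path:
  assumes "is_walk E ps"
  shows "\<exists>qs. is_path E (hd ps) (last ps) qs"
  using assms
proof (induction ps)
  case Nil
  then show ?case by (simp add: is_walk_def)
next
  case (Cons a ps)
  show ?case
  proof (cases "ps = []")
    case True
    then show ?thesis by (auto simp: is_path_def is_walk_iff_successively intro!: exI[of _ "[a]"])
  next
    case False
    then obtain qs where qs: "is_path E (hd ps) (last ps) qs" and e: "{a, hd ps} \<in> E"
      using Cons by (auto simp: is_walk_iff_successively successively_Cons)
    show ?thesis
    proof (cases "a \<in> set qs")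
      case True
      then obtain xs ys where "qs = xs @ a # ys" using split_list by metis
      then have "is_path E a (last ps) (a # ys)" using qs
        by (auto simp: is_path_def is_walk_iff_successively successively_append_iff)
      then show ?thesis using False by auto
    next
      case nin: False
      have "is_path E a (last ps) (a # qs)" using qs e nin
        by (auto simp: is_path_def is_walk_iff_successively successively_Cons)
      then show ?thesis using False by auto
    qed
  qed
qed

text \<open>The tree is kept only through parents and root paths: \<open>P \<alpha>\<close> lists
  the vertices from \<open>\<rho>\<close> to \<open>\<alpha>\<close>. The value
  \<open>par \<rho>\<close> is left unspecified. Edges reappear as the pairs of a vertex and its
  parent.\<close>

locale rooted_tree =
  fixes \<rho> :: "'v::finite" and par :: "'v \<Rightarrow> 'v" and P :: "'v \<Rightarrow> 'v list"
  assumes P_root: "P \<rho> = [\<rho>]"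
    and P_step: "\<alpha> \<noteq> \<rho> \<Longrightarrow> P \<alpha> = P (par \<alpha>) @ [\<alpha>]"
    and P_distinct: "distinct (P \<alpha>)"

text \<open>The parent is the last vertex but one of the root path. By uniqueness of paths, every
  initial segment of a root path is itself a root path.\<close>

lemma tree_imp_rooted_tree:
  fixes E :: "('v::finite) set set"
  assumes tree: "is_tree E"
  obtains par P where "rooted_tree \<rho> par P" "E = {{\<alpha>, par \<alpha>} | \<alpha>. \<alpha> \<noteq> \<rho>}"
    "\<And>\<alpha>. \<alpha> \<noteq> \<rho> \<Longrightarrow> is_parent E \<rho> (par \<alpha>) \<alpha>"
proof -
  have card: "\<And>e. e \<in> E \<Longrightarrow> card e = 2" and nc: "\<nexists>ps. is_cycle E ps"
    using tree by (auto simp: is_tree_def)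
  have "\<exists>ps. is_path E \<rho> a ps" for a
    using tree walk_imp_path by (metis is_tree_def)
  then obtain P where P: "\<And>a. is_path E \<rho> a (P a)" by metis
  have uniq: "is_path E \<rho> a ps \<Longrightarrow> ps = P a" for a ps using path_unique[OF nc] P by blast
  define par where "par a = last (butlast (P a))" for a
  have root: "P \<rho> = [\<rho>]"
    by (rule uniq[symmetric]) (simp add: is_path_def is_walk_def)
  have step: "P a = P (par a) @ [a] \<and> {a, par a} \<in> E" if "a \<noteq> \<rho>" for a
  proof -
    obtain xs where xs: "P a = xs @ [a]"
      using P[of a] unfolding is_path_def is_walk_def by (metis append_butlast_last_id)
    have "xs \<noteq> []" using P[of a] that xs by (auto simp: is_path_def)
    then have "is_path E \<rho> (last xs) xs" "{last xs, a} \<in> E"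
      using P[of a] xs by (auto simp: is_path_def is_walk_iff_successively successively_append_iff)
    then show ?thesis using uniq[of "last xs" xs] xs by (simp add: par_def insert_commute)
  qed
  \<comment> \<open>One endpoint of an edge is missing from the root path of the other, and the edge
    then extends that path by one step.\<close>
  have edge: "\<exists>c. {a, b} = {c, par c} \<and> c \<noteq> \<rho>" if e: "{a, b} \<in> E" for a b
  proof -
    have ab: "a \<noteq> b" using card[OF e] by auto
    have ext: "\<exists>c. {a, b} = {c, par c} \<and> c \<noteq> \<rho>" if "{a, b} \<in> E" "a \<notin> set (P b)" for a b
    proof -
      have "is_path E \<rho> a (P b @ [a])" using P[of b] that
        by (auto simp: is_path_def is_walk_iff_successively successively_append_iff insert_commute)
      then have Pa: "P a = P b @ [a]" using uniq by metis
      have "P b \<noteq> []" using P[of b] by (simp add: is_path_def is_walk_def)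
      then have "last (P b) = par a" "a \<noteq> \<rho>" using Pa root by (auto simp: par_def)
      then show ?thesis using P[of b] by (auto simp: is_path_def)
    qed
    show ?thesis
    proof (cases "a \<in> set (P b)")
      case False
      then show ?thesis using ext e by blast
    next
      case True
      \<comment> \<open>Otherwise \<open>P a\<close> would be an initial segment of
        \<open>P b\<close> containing \<open>b\<close>, and \<open>b\<close> would occur twice on
        its own root path.\<close>
      have "b \<notin> set (P a)"
      proof
        assume b: "b \<in> set (P a)"
        obtain xs ys where x: "P b = xs @ a # ys" using True split_list by metis
        have "hd (P b) = hd (xs @ [a])" using x by (cases xs) auto
        then have "is_path E \<rho> a (xs @ [a])" using P[of b] x
          by (auto simp: is_path_def is_walk_iff_successively successively_append_iff)
        then have "P a = xs @ [a]" using uniq by metis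
        then have "b \<in> set xs" using b ab by auto
        moreover have "last (a # ys) = b" using P[of b] x by (simp add: is_path_def)
        then have "b \<in> set ys" using ab by (metis last_ConsL last_ConsR last_in_set)
        ultimately show False using P[of b] x by (auto simp: is_path_def)
      qed
      then show ?thesis using ext[of b a] e by (simp add: insert_commute)
    qed
  qed
  show thesis
  proof
    show "rooted_tree \<rho> par P" using root step P by unfold_locales (auto simp: is_path_def)
    show "E = {{\<alpha>, par \<alpha>} | \<alpha>. \<alpha> \<noteq> \<rho>}"
    proof (intro equalityI subsetI)
      fix e assume "e \<in> E"
      moreover then obtain a b where "e = {a, b}" using card by (metis card_2_iff)
      ultimately show "e \<in> {{\<alpha>, par \<alpha>} | \<alpha>. \<alpha> \<noteq> \<rho>}" using edge by blast
    qed (use step in auto)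
    show "is_parent E \<rho> (par a) a" if "a \<noteq> \<rho>" for a
    proof -
      have "par a \<in> set (P (par a))" using P[of "par a"] unfolding is_path_def is_walk_def
        by (metis last_in_set)
      then have "par a \<in> set (P a)" using step[OF that] by simp
      moreover have "par a \<noteq> a" using step[OF that] card[of "{a, par a}"] by auto
      ultimately have "tree_le E \<rho> (par a) a" "par a \<noteq> a" using P by (auto simp: tree_le_def)
      then show ?thesis using step[OF that] by (simp add: is_parent_def insert_commute)
    qed
  qed
qed

context rooted_tree
begin

section \<open>Induction, recursion and edge coordinates along root paths\<close>

lemma tree_induct [case_names root step]:
  assumes "Q \<rho>" "\<And>\<alpha>. \<alpha> \<noteq> \<rho> \<Longrightarrow> Q (par \<alpha>) \<Longrightarrow> Q \<alpha>"
  shows "Q \<alpha>"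
proof (induction "length (P \<alpha>)" arbitrary: \<alpha> rule: less_induct)
  case less
  then show ?case using assms P_step[of \<alpha>] by (cases "\<alpha> = \<rho>") auto
qed

lemma P_nonempty: "P \<alpha> \<noteq> []"
  by (cases "\<alpha> = \<rho>") (simp_all add: P_root P_step)

text \<open>Recursion over parents as a fold along the root path, with value \<open>r\<close> at
  \<open>\<rho>\<close>; no termination argument for \<open>par\<close> arises.\<close>

definition tree_rec :: "'r \<Rightarrow> ('v \<Rightarrow> 'r \<Rightarrow> 'r) \<Rightarrow> 'v \<Rightarrow> 'r" where
  "tree_rec r g \<alpha> = fold g (tl (P \<alpha>)) r"

lemma tree_rec_root: "tree_rec r g \<rho> = r"
  by (simp add: tree_rec_def P_root)

lemma tree_rec_step: "\<alpha> \<noteq> \<rho> \<Longrightarrow> tree_rec r g \<alpha> = g \<alpha> (tree_rec r g (par \<alpha>))"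
  by (simp add: tree_rec_def P_step P_nonempty)

lemma P_par: "\<alpha> \<noteq> \<rho> \<Longrightarrow> \<alpha> \<notin> set (P (par \<alpha>))"
  using P_distinct[of \<alpha>] P_step[of \<alpha>] by simp

lemma self_in_P: "\<alpha> \<in> set (P \<alpha>)"
  by (cases "\<alpha> = \<rho>") (simp_all add: P_root P_step)

lemma P_mono: "\<beta> \<in> set (P \<alpha>) \<Longrightarrow> length (P \<beta>) \<le> length (P \<alpha>) \<and> (\<beta> \<noteq> \<alpha> \<longrightarrow> length (P \<beta>) < length (P \<alpha>))"
proof (induction \<alpha> rule: tree_induct)
  case root
  then show ?case by (simp add: P_root)
next
  case (step \<alpha>)
  then show ?case by (auto simp: P_step)
qed

lemma P_antisym: "\<alpha> \<in> set (P \<beta>) \<Longrightarrow> \<beta> \<in> set (P \<alpha>) \<Longrightarrow> \<alpha> = \<beta>"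
  using P_mono[of \<alpha> \<beta>] P_mono[of \<beta> \<alpha>] by fastforce

text \<open>\<open>slide \<alpha>\<close> is the cyclic permutation of the path from \<open>\<rho>\<close> to \<open>\<alpha>\<close> that maps each
  \<open>\<gamma> \<noteq> \<rho>\<close> on it to its parent and \<open>\<rho>\<close> to \<open>\<alpha>\<close>. For \<open>\<gamma> \<noteq> \<rho>\<close>, \<open>slide \<alpha> \<gamma>\<close> is thus the endpoint
  farther from \<open>\<alpha>\<close> of the edge between \<open>\<gamma>\<close> and its parent.\<close>

definition slide :: "'v \<Rightarrow> 'v \<Rightarrow> 'v" where
  "slide = tree_rec id (\<lambda>\<alpha> s. Transposition.transpose \<alpha> (par \<alpha>) \<circ> s)"

lemma slide_root: "slide \<rho> = id"
  by (simp add: slide_def tree_rec_root)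

lemma slide_step: "\<alpha> \<noteq> \<rho> \<Longrightarrow> slide \<alpha> = Transposition.transpose \<alpha> (par \<alpha>) \<circ> slide (par \<alpha>)"
  by (simp add: slide_def tree_rec_step)

lemma bij_slide: "bij (slide \<alpha>)"
proof (induction \<alpha> rule: tree_induct)
  case root
  show ?case unfolding slide_root by (rule bij_id)
next
  case (step \<alpha>)
  then show ?case unfolding slide_step[OF step(1)] by (intro bij_comp bij_swap) simp_all
qed

lemma slide_at_root: "slide \<alpha> \<rho> = \<alpha>"
  by (induction \<alpha> rule: tree_induct) (auto simp: slide_root slide_step)

lemma slide_outside: "\<gamma> \<notin> set (P \<alpha>) \<Longrightarrow> slide \<alpha> \<gamma> = \<gamma>"
proof (induction \<alpha> rule: tree_induct)
  case (step \<alpha>)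
  then have "\<gamma> \<noteq> \<alpha>" "\<gamma> \<noteq> par \<alpha>" using self_in_P[of "par \<alpha>"] by (auto simp: P_step)
  then show ?case using step by (simp add: slide_step P_step transpose_def)
qed (simp add: slide_root)

lemma slide_self: "\<alpha> \<noteq> \<rho> \<Longrightarrow> slide \<alpha> \<alpha> = par \<alpha>"
  by (simp add: slide_step slide_outside P_par)

text \<open>The edge between \<open>\<gamma>\<close> and its parent is labelled by
  \<open>\<gamma>\<close>. The spare label \<open>\<rho>\<close> receives
  \<open>x $ \<alpha>\<close>, which is \<open>0\<close> on \<open>arb_copy \<alpha>\<close>, so all
  copies become the same hyperplane \<open>y $ \<rho> = 0\<close>.\<close>

definition to_edge :: "'v \<Rightarrow> real^'v \<Rightarrow> real^'v" where
  "to_edge \<alpha> x = (\<chi> \<gamma>. x $ slide \<alpha> \<gamma>)"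

definition from_edge :: "'v \<Rightarrow> real^'v \<Rightarrow> real^'v" where
  "from_edge \<alpha> y = (\<chi> \<delta>. y $ inv (slide \<alpha>) \<delta>)"

lemma from_to_edge [simp]: "from_edge \<alpha> (to_edge \<alpha> x) = x"
  by (simp add: from_edge_def to_edge_def vec_eq_iff surj_f_inv_f bij_is_surj bij_slide)

lemma to_from_edge [simp]: "to_edge \<alpha> (from_edge \<alpha> y) = y"
  by (simp add: from_edge_def to_edge_def vec_eq_iff inv_f_f bij_is_inj bij_slide)

lemma to_edge_root: "to_edge \<alpha> x $ \<rho> = x $ \<alpha>"
  by (simp add: to_edge_def slide_at_root)

lemma from_edge_in_copy: "from_edge \<alpha> y \<in> arb_copy \<alpha> \<longleftrightarrow> y $ \<rho> = 0"
  using to_edge_root[of \<alpha> "from_edge \<alpha> y"] by (simp add: arb_copy_def)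

lemma continuous_to_edge: "continuous_on A (to_edge \<alpha>)"
  unfolding to_edge_def by (intro continuous_intros)

lemma continuous_from_edge: "continuous_on A (from_edge \<alpha>)"
  unfolding from_edge_def by (intro continuous_intros)

text \<open>The last vertex on the root path whose edge to its parent is negative, or
  \<open>\<rho>\<close> if there is none: the top of the component of
  \<open>\<alpha>\<close>.\<close>

definition top_of :: "real^'v \<Rightarrow> 'v \<Rightarrow> 'v" where
  "top_of y = tree_rec \<rho> (\<lambda>\<alpha> t. if y $ \<alpha> < 0 then \<alpha> else t)"

lemma top_of_root: "top_of y \<rho> = \<rho>"
  by (simp add: top_of_def tree_rec_root)

lemma top_of_step: "\<alpha> \<noteq> \<rho> \<Longrightarrow> top_of y \<alpha> = (if y $ \<alpha> < 0 then \<alpha> else top_of y (par \<alpha>))"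
  by (simp add: top_of_def tree_rec_step)

lemma top_of_cong: "(\<And>\<gamma>. \<gamma> \<noteq> \<rho> \<Longrightarrow> y $ \<gamma> = y' $ \<gamma>) \<Longrightarrow> top_of y \<alpha> = top_of y' \<alpha>"
  by (induction \<alpha> rule: tree_induct) (auto simp: top_of_root top_of_step)

section \<open>Equivalence classes as components of the forest of nonnegative edges\<close>

context
  fixes E :: "'v set set"
  assumes E: "E = {{\<alpha>, par \<alpha>} | \<alpha>. \<alpha> \<noteq> \<rho>}"
begin

text \<open>\<open>slide \<alpha>\<close> and \<open>slide (par \<alpha>)\<close> differ by the
  transposition of the two endpoints, which is exactly the exchange of coordinates in the gluing.
  The glued points therefore have equal edge coordinates, and the sign condition concerns the
  coordinate of the edge crossed.\<close>

lemma arb_rel_child: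
  assumes "\<alpha> \<noteq> \<rho>"
  shows "arb_rel E (\<alpha>, x) (par \<alpha>, y) \<longleftrightarrow>
    x \<in> arb_copy \<alpha> \<and> to_edge (par \<alpha>) y = to_edge \<alpha> x \<and> to_edge \<alpha> x $ \<alpha> \<ge> 0"
proof -
  have ne: "par \<alpha> \<noteq> \<alpha>" using P_par[OF assms] self_in_P by metis
  have e: "{\<alpha>, par \<alpha>} \<in> E" using assms E by auto
  have "to_edge (par \<alpha>) y = to_edge \<alpha> x \<longleftrightarrow> (\<forall>\<gamma>. y $ \<gamma> = x $ Transposition.transpose \<alpha> (par \<alpha>) \<gamma>)"
    (is "_ \<longleftrightarrow> (\<forall>\<gamma>. ?Q \<gamma>)")
  proof -
    \<comment> \<open>The entries are reindexed along the bijection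
      \<open>slide (par \<alpha>)\<close>.\<close>
    have "to_edge (par \<alpha>) y = to_edge \<alpha> x \<longleftrightarrow> (\<forall>\<gamma>. ?Q (slide (par \<alpha>) \<gamma>))"
      using assms by (simp add: to_edge_def vec_eq_iff slide_step)
    also have "\<dots> \<longleftrightarrow> (\<forall>\<gamma>\<in>range (slide (par \<alpha>)). ?Q \<gamma>)" by blast
    finally show ?thesis by (simp only: bij_is_surj[OF bij_slide] ball_UNIV)
  qed
  moreover have "to_edge \<alpha> x $ \<alpha> = x $ par \<alpha>" using assms by (simp add: to_edge_def slide_self)
  moreover have "(\<forall>\<gamma>. y $ \<gamma> = x $ Transposition.transpose \<alpha> (par \<alpha>) \<gamma>) \<longleftrightarrow>
      y $ \<alpha> = x $ par \<alpha> \<and> y $ par \<alpha> = x $ \<alpha> \<and> (\<forall>\<gamma>. \<gamma> \<noteq> \<alpha> \<and> \<gamma> \<noteq> par \<alpha> \<longrightarrow> x $ \<gamma> = y $ \<gamma>)"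
    by (metis transpose_apply_first transpose_apply_second transpose_apply_other)
  moreover have "arb_rel E (\<alpha>, x) (par \<alpha>, y) \<longleftrightarrow> x $ \<alpha> = 0 \<and> y $ par \<alpha> = 0 \<and> x $ par \<alpha> = y $ \<alpha> \<and>
      x $ par \<alpha> \<ge> 0 \<and> (\<forall>\<gamma>. \<gamma> \<noteq> \<alpha> \<and> \<gamma> \<noteq> par \<alpha> \<longrightarrow> x $ \<gamma> = y $ \<gamma>)"
    using e by (simp add: arb_rel_def arb_copy_def)
  ultimately show ?thesis unfolding arb_copy_def mem_Collect_eq by metis
qed

lemma arb_rel_sym: "arb_rel E p q \<Longrightarrow> arb_rel E q p"
  by (auto simp: arb_rel_def insert_commute)

lemma arb_rel_invariant:
  assumes "arb_rel E (\<alpha>, x) (\<beta>, y)"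
  shows "to_edge \<alpha> x = to_edge \<beta> y \<and> top_of (to_edge \<alpha> x) \<alpha> = top_of (to_edge \<beta> y) \<beta>"
proof -
  have "{\<alpha>, \<beta>} \<in> E" using assms by (simp add: arb_rel_def)
  then consider "\<alpha> \<noteq> \<rho>" "\<beta> = par \<alpha>" | "\<beta> \<noteq> \<rho>" "\<alpha> = par \<beta>"
    by (auto simp: E doubleton_eq_iff)
  then show ?thesis
  proof cases
    case 1
    then show ?thesis using arb_rel_child[of \<alpha> x y] assms by (simp add: top_of_step)
  next
    case 2
    then show ?thesis using arb_rel_child[of \<beta> y x] arb_rel_sym[OF assms] by (simp add: top_of_step)
  qed
qed

text \<open>Normal form: crossing nonnegative edges towards \<open>\<rho>\<close> moves a point into
  the copy of the top of its component without changing its edge coordinates.\<close>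

lemma arb_equiv_top:
  assumes "y $ \<rho> = 0"
  shows "(sup (arb_rel E) (arb_rel E)\<inverse>\<inverse>)\<^sup>*\<^sup>* (\<alpha>, from_edge \<alpha> y) (top_of y \<alpha>, from_edge (top_of y \<alpha>) y)"
proof (induction \<alpha> rule: tree_induct)
  case (step \<alpha>)
  show ?case
  proof (cases "y $ \<alpha> < 0")
    case False
    then have "arb_rel E (\<alpha>, from_edge \<alpha> y) (par \<alpha>, from_edge (par \<alpha>) y)"
      using step assms by (simp add: arb_rel_child from_edge_in_copy)
    then have "(sup (arb_rel E) (arb_rel E)\<inverse>\<inverse>) (\<alpha>, from_edge \<alpha> y) (par \<alpha>, from_edge (par \<alpha>) y)" by simp
    from converse_rtranclp_into_rtranclp[of "sup (arb_rel E) (arb_rel E)\<inverse>\<inverse>", OF this step(2)]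
    show ?thesis by (simp only: top_of_step[OF step(1)] False if_False)
  qed (simp add: step top_of_step)
qed (simp add: top_of_root)

text \<open>Edge coordinates and top form a complete invariant: gluings preserve both, and points
  that share them are equivalent to the same representative in the copy of the top.\<close>

lemma arb_class_eq_iff:
  assumes "x \<in> arb_copy \<alpha>" "y \<in> arb_copy \<beta>"
  shows "arb_class E (\<alpha>, x) = arb_class E (\<beta>, y) \<longleftrightarrow>
    to_edge \<alpha> x = to_edge \<beta> y \<and> top_of (to_edge \<alpha> x) \<alpha> = top_of (to_edge \<alpha> x) \<beta>"
proof -
  let ?R = "(sup (arb_rel E) (arb_rel E)\<inverse>\<inverse>)\<^sup>*\<^sup>*"
  have sym: "?R p q \<Longrightarrow> ?R q p" for p q
    by (induction rule: rtranclp_induct) (auto intro: converse_rtranclp_into_rtranclp)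
  have inv: "?R p q \<Longrightarrow> to_edge (fst p) (snd p) = to_edge (fst q) (snd q) \<and>
      top_of (to_edge (fst p) (snd p)) (fst p) = top_of (to_edge (fst q) (snd q)) (fst q)" for p q
  proof (induction rule: rtranclp_induct)
    case (step q r)
    have "arb_rel E q r \<or> arb_rel E r q" using step by auto
    then have "to_edge (fst q) (snd q) = to_edge (fst r) (snd r) \<and>
      top_of (to_edge (fst q) (snd q)) (fst q) = top_of (to_edge (fst r) (snd r)) (fst r)"
      using arb_rel_invariant[of "fst q" "snd q" "fst r" "snd r"]
        arb_rel_invariant[of "fst r" "snd r" "fst q" "snd q"] by auto
    then show ?case using step.IH by metis
  qed simp
  have "arb_class E (\<alpha>, x) = arb_class E (\<beta>, y) \<longleftrightarrow> ?R (\<alpha>, x) (\<beta>, y)"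
    unfolding arb_class_def using sym rtranclp_trans[of "sup (arb_rel E) (arb_rel E)\<inverse>\<inverse>"] by blast
  also have "\<dots> \<longleftrightarrow> to_edge \<alpha> x = to_edge \<beta> y \<and> top_of (to_edge \<alpha> x) \<alpha> = top_of (to_edge \<alpha> x) \<beta>"
  proof
    assume "?R (\<alpha>, x) (\<beta>, y)"
    from inv[OF this] show "to_edge \<alpha> x = to_edge \<beta> y \<and> top_of (to_edge \<alpha> x) \<alpha> = top_of (to_edge \<alpha> x) \<beta>"
      by (metis fst_conv snd_conv)
  next
    assume a: "to_edge \<alpha> x = to_edge \<beta> y \<and> top_of (to_edge \<alpha> x) \<alpha> = top_of (to_edge \<alpha> x) \<beta>"
    have "to_edge \<alpha> x $ \<rho> = 0" using assms by (simp add: to_edge_root arb_copy_def)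
    note e = arb_equiv_top[OF this]
    have "?R (\<alpha>, x) (top_of (to_edge \<alpha> x) \<alpha>, from_edge (top_of (to_edge \<alpha> x) \<alpha>) (to_edge \<alpha> x))"
      using e[of \<alpha>] by simp
    moreover have "?R (\<beta>, y) (top_of (to_edge \<alpha> x) \<alpha>, from_edge (top_of (to_edge \<alpha> x) \<alpha>) (to_edge \<alpha> x))"
      using e[of \<beta>] a by (metis from_to_edge)
    ultimately show "?R (\<alpha>, x) (\<beta>, y)" using sym by (blast intro: rtranclp_trans)
  qed
  finally show ?thesis .
qed

end

end

section \<open>Projectivized cotangent bundles and conormals\<close>

lemma openin_quotient_topology:
  "openin (quotient_topology X q) U \<longleftrightarrow>
    U \<subseteq> q ` topspace X \<and> openin X {p \<in> topspace X. q p \<in> U}"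
proof -
  let ?L = "\<lambda>U. U \<subseteq> q ` topspace X \<and> openin X {p \<in> topspace X. q p \<in> U}"
  have "istopology ?L"
    unfolding istopology_def
  proof (intro conjI allI impI)
    fix S T assume "?L S" "?L T"
    moreover have "{p \<in> topspace X. q p \<in> S \<inter> T} = {p \<in> topspace X. q p \<in> S} \<inter> {p \<in> topspace X. q p \<in> T}"
      by auto
    ultimately show "S \<inter> T \<subseteq> q ` topspace X" "openin X {p \<in> topspace X. q p \<in> S \<inter> T}" by auto
  next
    fix \<K> assume K: "\<forall>K\<in>\<K>. ?L K"
    have "{p \<in> topspace X. q p \<in> \<Union>\<K>} = \<Union>((\<lambda>K. {p \<in> topspace X. q p \<in> K}) ` \<K>)" by auto
    then show "openin X {p \<in> topspace X. q p \<in> \<Union>\<K>}" using K by auto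
    show "\<Union>\<K> \<subseteq> q ` topspace X" using K by blast
  qed
  then show ?thesis by (simp add: quotient_topology_def)
qed

lemma topspace_quotient_topology [simp]: "topspace (quotient_topology X q) = q ` topspace X"
proof
  show "topspace (quotient_topology X q) \<subseteq> q ` topspace X"
    by (rule openin_quotient_topology[THEN iffD1, OF openin_topspace, THEN conjunct1])
  have "{p \<in> topspace X. q p \<in> q ` topspace X} = topspace X" by auto
  then have "openin (quotient_topology X q) (q ` topspace X)"
    by (simp add: openin_quotient_topology)
  then show "q ` topspace X \<subseteq> topspace (quotient_topology X q)" by (rule openin_subset)
qed

lemma quotient_map_quotient_topology: "quotient_map X (quotient_topology X q) q"
  by (simp add: quotient_map_def openin_quotient_topology)

section \<open>Lines and rays of covectors\<close>

lemma line_of_scale: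
  assumes "c \<noteq> 0"
  shows "line_of (c *\<^sub>R \<xi>) = line_of \<xi>"
proof -
  have sub: "line_of (c *\<^sub>R \<xi>) \<subseteq> line_of \<xi>" for c :: real and \<xi> :: 'a
    by (auto simp: line_of_def image_iff)
  show ?thesis using sub[of c \<xi>] sub[of "1 / c" "c *\<^sub>R \<xi>"] assms by simp
qed

lemma ray_of_scale:
  assumes "c > 0"
  shows "ray_of (c *\<^sub>R \<xi>) = ray_of \<xi>"
proof -
  have sub: "ray_of (c *\<^sub>R \<xi>) \<subseteq> ray_of \<xi>" if "c > 0" for c :: real and \<xi> :: 'a
  proof
    fix x assume "x \<in> ray_of (c *\<^sub>R \<xi>)"
    then obtain a where "a > 0" "x = (a * c) *\<^sub>R \<xi>" by (auto simp: ray_of_def)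
    then show "x \<in> ray_of \<xi>" using that mult_pos_pos unfolding ray_of_def by blast
  qed
  show ?thesis using sub[of c \<xi>] sub[of "1 / c" "c *\<^sub>R \<xi>"] assms by simp
qed

lemma line_of_eqD:
  assumes "line_of \<xi> = line_of \<eta>" "\<xi> \<noteq> 0"
  obtains c where "c \<noteq> 0" "\<xi> = c *\<^sub>R \<eta>"
proof -
  have "\<xi> \<in> line_of \<xi>" unfolding line_of_def by (rule range_eqI[of _ _ 1]) simp
  then obtain c where "\<xi> = c *\<^sub>R \<eta>" using assms by (auto simp: line_of_def)
  then show thesis using that assms(2) by (cases "c = 0") auto
qed

text \<open>The equality case of Cauchy-Schwarz, written without division so that parallelism
  becomes a closed condition on pairs of covectors.\<close>

lemma line_of_eq_iff_inner:
  fixes \<xi> \<eta> :: "'a::real_inner"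
  assumes "\<xi> \<noteq> 0" "\<eta> \<noteq> 0"
  shows "line_of \<xi> = line_of \<eta> \<longleftrightarrow> (\<eta> \<bullet> \<eta>) *\<^sub>R \<xi> = (\<xi> \<bullet> \<eta>) *\<^sub>R \<eta>"
proof
  assume "line_of \<xi> = line_of \<eta>"
  then show "(\<eta> \<bullet> \<eta>) *\<^sub>R \<xi> = (\<xi> \<bullet> \<eta>) *\<^sub>R \<eta>"
    using assms(1) by (elim line_of_eqD) auto
next
  assume e: "(\<eta> \<bullet> \<eta>) *\<^sub>R \<xi> = (\<xi> \<bullet> \<eta>) *\<^sub>R \<eta>"
  have "\<xi> = ((\<xi> \<bullet> \<eta>) / (\<eta> \<bullet> \<eta>)) *\<^sub>R \<eta>"
    using assms arg_cong[OF e, of "\<lambda>v. (1 / (\<eta> \<bullet> \<eta>)) *\<^sub>R v"] by (simp add: divide_inverse mult.commute)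
  then show "line_of \<xi> = line_of \<eta>"
    using line_of_scale[of "(\<xi> \<bullet> \<eta>) / (\<eta> \<bullet> \<eta>)" \<eta>] assms(1) by fastforce
qed

lemma ray_line_ray_of: "ray_line (ray_of \<xi>) = line_of \<xi>"
proof -
  have "a *\<^sub>R \<xi> \<in> ray_line (ray_of \<xi>)" for a
  proof (cases "a = 0 \<or> a > 0")
    case False
    then have "(-a) *\<^sub>R \<xi> \<in> ray_of \<xi>" by (auto simp: ray_of_def intro!: exI[of _ "-a"])
    then have "- ((-a) *\<^sub>R \<xi>) \<in> uminus ` ray_of \<xi>" by (rule imageI)
    then show ?thesis by (simp add: ray_line_def)
  qed (auto simp: ray_line_def ray_of_def)
  moreover have "x \<in> line_of \<xi>" if "x \<in> ray_line (ray_of \<xi>)" for x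
    using that unfolding ray_line_def ray_of_def line_of_def
    by (auto simp: image_iff) (metis scaleR_minus_left scaleR_zero_left)+
  ultimately show ?thesis by (auto simp: line_of_def)
qed

section \<open>Sections of the projectivized bundles and conormal directions\<close>

lemma topspace_PstarM: "topspace PstarM = {(x, line_of \<xi>) | x \<xi>. \<xi> \<noteq> 0}"
  by (auto simp: PstarM_def nonzero_cotangent_def)

lemma continuous_map_fst_PstarM: "continuous_map PstarM euclidean fst"
  unfolding PstarM_def
  by (rule continuous_compose_quotient_map[OF quotient_map_quotient_topology])
    (simp add: nonzero_cotangent_def o_def case_prod_unfold continuous_intros)

lemma continuous_map_line_of:
  fixes G :: "'a::real_normed_vector \<Rightarrow> 'a"
  assumes "continuous_on A G" "\<And>x. x \<in> A \<Longrightarrow> G x \<noteq> 0"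
  shows "continuous_map (top_of_set A) PstarM (\<lambda>x. (x, line_of (G x)))"
proof -
  have "continuous_map (top_of_set A) nonzero_cotangent (\<lambda>x. (x, G x))"
    unfolding nonzero_cotangent_def using assms
    by (auto intro!: continuous_intros)
  from continuous_map_compose[OF this quotient_imp_continuous_map[OF quotient_map_quotient_topology[of _ "\<lambda>(x, \<xi>). (x, line_of \<xi>)"]]]
  show ?thesis by (simp add: PstarM_def o_def)
qed

lemma continuous_map_ray_of:
  fixes G :: "'a::real_normed_vector \<Rightarrow> 'a"
  assumes "continuous_on A G" "\<And>x. x \<in> A \<Longrightarrow> G x \<noteq> 0"
  shows "continuous_map (top_of_set A) SstarM (\<lambda>x. (x, ray_of (G x)))"
proof -
  have "continuous_map (top_of_set A) nonzero_cotangent (\<lambda>x. (x, G x))"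
    unfolding nonzero_cotangent_def using assms
    by (auto intro!: continuous_intros)
  from continuous_map_compose[OF this quotient_imp_continuous_map[OF quotient_map_quotient_topology[of _ "\<lambda>(x, \<xi>). (x, ray_of \<xi>)"]]]
  show ?thesis by (simp add: SstarM_def o_def)
qed

text \<open>A set is closed in the quotient iff its preimage among the nonzero covectors is. Here
  the preimage is cut out by the base point lying in \<open>K\<close> and by parallelism to
  \<open>G\<close>, both closed conditions.\<close>

lemma closedin_PstarM_lines:
  fixes G :: "'a::real_inner \<Rightarrow> 'a"
  assumes G: "continuous_on UNIV G" "\<And>x. G x \<noteq> 0" and K: "closed K"
  shows "closedin PstarM ((\<lambda>x. (x, line_of (G x))) ` K)" (is "closedin _ ?S")
proof -
  have sub: "?S \<subseteq> topspace PstarM" using G(2) by (auto simp: topspace_PstarM)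
  have eq: "{p \<in> topspace nonzero_cotangent. (\<lambda>(x, \<xi>). (x, line_of \<xi>)) p \<in> ?S} =
      {(x, \<xi>). \<xi> \<noteq> 0} \<inter> ((fst -` K) \<inter>
        {p. (G (fst p) \<bullet> G (fst p)) *\<^sub>R snd p = (snd p \<bullet> G (fst p)) *\<^sub>R G (fst p)})"
    using G(2) by (auto simp: nonzero_cotangent_def line_of_eq_iff_inner)
  have "continuous_on UNIV (\<lambda>p::'a \<times> 'a. G (fst p))"
    using continuous_on_compose2[OF G(1) continuous_on_fst[OF continuous_on_id]] by simp
  then have "closed {p. (G (fst p) \<bullet> G (fst p)) *\<^sub>R snd p = (snd p \<bullet> G (fst p)) *\<^sub>R G (fst p)}"
    by (intro closed_Collect_eq continuous_on_scaleR continuous_on_inner continuous_on_snd continuous_on_id)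
  then have "closed ((fst -` K) \<inter>
        {p. (G (fst p) \<bullet> G (fst p)) *\<^sub>R snd p = (snd p \<bullet> G (fst p)) *\<^sub>R G (fst p)})"
    using closed_vimage[OF K continuous_on_fst[OF continuous_on_id]] by (rule closed_Int[rotated])
  from closedin_closed_Int[OF this] have "closedin nonzero_cotangent
      {p \<in> topspace nonzero_cotangent. (\<lambda>(x, \<xi>). (x, line_of \<xi>)) p \<in> ?S}"
    unfolding eq by (simp only: nonzero_cotangent_def)
  then show ?thesis
    using quotient_map_quotient_topology[of nonzero_cotangent "\<lambda>(x, \<xi>). (x, line_of \<xi>)"] sub
    unfolding quotient_map_closedin PstarM_def by blast
qed

text \<open>If \<open>g\<close> vanishes on \<open>{h = 0}\<close> near \<open>x\<close>, then \<open>dg\<close> vanishes on \<open>ker dh\<close>: for \<open>v \<bottom> dh\<close> the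
  intermediate value theorem gives zeros \<open>x + t v + s n\<close> of \<open>h\<close> with \<open>s = o(t)\<close>, so the implicit
  function theorem is not needed.\<close>

lemma gradient_parallel:
  fixes h g :: "'a::real_inner \<Rightarrow> real"
  assumes h: "continuous_on UNIV h" "(h has_derivative (\<lambda>v. n \<bullet> v)) (at x)" "h x = 0" "n \<noteq> 0"
    and g: "(g has_derivative (\<lambda>v. m \<bullet> v)) (at x)" "g x = 0"
    and U: "open U" "x \<in> U" "\<And>y. y \<in> U \<Longrightarrow> h y = 0 \<Longrightarrow> g y = 0"
  shows "\<exists>c. m = c *\<^sub>R n"
proof -
  have ker: "m \<bullet> v = 0" if v: "n \<bullet> v = 0" for v
  proof (rule ccontr)
    define a where "a = \<bar>m \<bullet> v\<bar>"
    assume "m \<bullet> v \<noteq> 0"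
    then have a: "a > 0" by (simp add: a_def)
    define K where "K = norm v + norm n"
    have K: "K > 0" using h(4) by (simp add: K_def add_nonneg_pos)
    \<comment> \<open>Chosen so that \<open>|s| \<le> \<epsilon> * t\<close> bounds
      \<open>s * (m \<bullet> n)\<close> by \<open>t * a / 3\<close>; the \<open>+ 1\<close> covers
      \<open>m \<bullet> n = 0\<close>.\<close>
    define \<epsilon> where "\<epsilon> = min 1 (a / (3 * (\<bar>m \<bullet> n\<bar> + 1)))"
    have e: "0 < \<epsilon>" "\<epsilon> \<le> 1" using a by (auto simp: \<epsilon>_def)
    have "\<epsilon> \<le> a / (3 * (\<bar>m \<bullet> n\<bar> + 1))" by (simp add: \<epsilon>_def)
    then have "\<epsilon> * (3 * (\<bar>m \<bullet> n\<bar> + 1)) \<le> a" by (subst (asm) pos_le_divide_eq) auto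
    then have e3: "\<epsilon> * \<bar>m \<bullet> n\<bar> \<le> a / 3" using e by (simp add: algebra_simps)
    have nn: "n \<bullet> n > 0" using h(4) by simp
    \<comment> \<open>Tolerances for the two linear approximations at distance at most
      \<open>t * K\<close>. The error of \<open>h\<close> is then at most half of its linear part at
      \<open>s = \<epsilon> * t\<close>, which fixes the signs at both ends, and the error of
      \<open>g\<close> is at most \<open>t * a / 3\<close>.\<close>
    have pos: "\<epsilon> * (n \<bullet> n) / (2 * K) > 0" "a / (3 * K) > 0" using e nn K a by auto
    obtain d d' where d: "d > 0" "\<And>y. norm (y - x) < d \<Longrightarrow>
          norm (h y - h x - n \<bullet> (y - x)) \<le> \<epsilon> * (n \<bullet> n) / (2 * K) * norm (y - x)"
      and d': "d' > 0" "\<And>y. norm (y - x) < d' \<Longrightarrow>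
          norm (g y - g x - m \<bullet> (y - x)) \<le> a / (3 * K) * norm (y - x)"
      using h(2)[unfolded has_derivative_at_alt, THEN conjunct2, rule_format, OF pos(1)]
        g(1)[unfolded has_derivative_at_alt, THEN conjunct2, rule_format, OF pos(2)] by blast
    obtain r where r: "r > 0" "ball x r \<subseteq> U" using U openE by blast
    \<comment> \<open>The factor \<open>2\<close> makes \<open>t * K\<close> strictly smaller than
      all three radii.\<close>
    define t where "t = min d (min d' r) / (2 * K)"
    have t: "t > 0" "t * K < d" "t * K < d'" "t * K < r"
      using d d' r K by (auto simp: t_def field_simps min_def)
    define p where "p s = x + t *\<^sub>R v + s *\<^sub>R n" for s
    have px: "norm (p s - x) \<le> t * K" if "\<bar>s\<bar> \<le> \<epsilon> * t" for s
    proof -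
      have "norm (p s - x) \<le> t * norm v + \<bar>s\<bar> * norm n"
        using t norm_triangle_ineq[of "t *\<^sub>R v" "s *\<^sub>R n"] by (simp add: p_def add.assoc)
      also have "\<bar>s\<bar> \<le> t" using that e t mult_right_mono[of \<epsilon> 1 t] by linarith
      then have "\<bar>s\<bar> * norm n \<le> t * norm n" by (simp add: mult_right_mono)
      finally show ?thesis by (simp add: K_def algebra_simps)
    qed
    have hp: "\<bar>h (p s) - s * (n \<bullet> n)\<bar> \<le> \<epsilon> * t * (n \<bullet> n) / 2" if s: "\<bar>s\<bar> \<le> \<epsilon> * t" for s
    proof -
      have "n \<bullet> (p s - x) = s * (n \<bullet> n)" using v by (simp add: p_def algebra_simps inner_simps)
      then have "\<bar>h (p s) - s * (n \<bullet> n)\<bar> \<le> \<epsilon> * (n \<bullet> n) / (2 * K) * norm (p s - x)"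
        using d(2)[of "p s"] px[OF s] t h(3) by simp
      also have "\<dots> \<le> \<epsilon> * (n \<bullet> n) / (2 * K) * (t * K)"
        using px[OF s] e nn K by (intro mult_left_mono) auto
      finally show ?thesis using K by (simp add: field_simps)
    qed
    have et: "\<epsilon> * t > 0" using e t by simp
    define q where "q = \<epsilon> * t * (n \<bullet> n)"
    have "q > 0" using et nn by (simp add: q_def)
    moreover have "\<bar>h (p (- (\<epsilon> * t))) + q\<bar> \<le> q / 2" "\<bar>h (p (\<epsilon> * t)) - q\<bar> \<le> q / 2"
      using hp[of "- (\<epsilon> * t)"] hp[of "\<epsilon> * t"] et by (simp_all add: q_def)
    ultimately have "h (p (- (\<epsilon> * t))) \<le> 0" "0 \<le> h (p (\<epsilon> * t))"
      by linarith+
    moreover have "continuous_on {- (\<epsilon> * t)..\<epsilon> * t} (\<lambda>s. h (p s))"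
      unfolding p_def by (intro continuous_on_compose2[OF h(1)] continuous_intros) auto
    ultimately obtain s where s: "- (\<epsilon> * t) \<le> s" "s \<le> \<epsilon> * t" "h (p s) = 0"
      using IVT'[of "\<lambda>s. h (p s)" "- (\<epsilon> * t)" 0 "\<epsilon> * t"] et by auto
    then have s': "\<bar>s\<bar> \<le> \<epsilon> * t" by auto
    have "dist x (p s) < r" using px[OF s'] t by (simp add: dist_norm norm_minus_commute)
    then have "p s \<in> U" using r by auto
    then have "g (p s) = 0" using U s by blast
    moreover have "m \<bullet> (p s - x) = t * (m \<bullet> v) + s * (m \<bullet> n)"
      by (simp add: p_def algebra_simps inner_simps)
    ultimately have "\<bar>t * (m \<bullet> v) + s * (m \<bullet> n)\<bar> \<le> a / (3 * K) * norm (p s - x)"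
      using d'(2)[of "p s"] px[OF s'] t g(2) by simp
    also have "\<dots> \<le> a / (3 * K) * (t * K)" using px[OF s'] a K by (intro mult_left_mono) auto
    also have "\<dots> = t * a / 3" using K by simp
    finally have "\<bar>t * (m \<bullet> v) + s * (m \<bullet> n)\<bar> \<le> t * a / 3" .
    moreover have "\<bar>s * (m \<bullet> n)\<bar> \<le> t * a / 3"
    proof -
      have "\<bar>s * (m \<bullet> n)\<bar> \<le> \<epsilon> * t * \<bar>m \<bullet> n\<bar>" using s' by (simp add: abs_mult mult_right_mono)
      also have "\<dots> \<le> t * a / 3" using mult_left_mono[OF e3, of t] t by (simp add: algebra_simps)
      finally show ?thesis .
    qed
    moreover have "\<bar>t * (m \<bullet> v)\<bar> = t * a" using t by (simp add: abs_mult a_def)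
    \<comment> \<open>Two errors of a third each cannot cancel a term of size
      \<open>t * a\<close>.\<close>
    ultimately have "t * a \<le> 2 * (t * a / 3)" by linarith
    moreover have "t * a > 0" using t a by simp
    ultimately show False by linarith
  qed
  \<comment> \<open>The component of \<open>m\<close> orthogonal to \<open>n\<close>; it lies in the
    kernel of \<open>n\<close>, hence is orthogonal to \<open>m\<close> and \<open>n\<close> and so
    to itself.\<close>
  define w where "w = m - ((m \<bullet> n) / (n \<bullet> n)) *\<^sub>R n"
  have nw: "n \<bullet> w = 0" using h(4) by (simp add: w_def inner_simps inner_commute)
  have "w \<bullet> w = 0" using ker[OF nw] nw by (simp add: w_def inner_diff_left)
  then have "m = ((m \<bullet> n) / (n \<bullet> n)) *\<^sub>R n" by (simp add: w_def)
  then show ?thesis ..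
qed

text \<open>A local defining function of \<open>H\<close> vanishes on \<open>{h = 0}\<close>, so its
  gradient is parallel to that of \<open>h\<close>. Since \<open>{h = 0}\<close> may be one sheet of
  \<open>H\<close>, all sheets through a smooth point of a union share its conormal line.\<close>

lemma conormal_imp_line:
  fixes h :: "'a::euclidean_space \<Rightarrow> real"
  assumes \<xi>: "conormal H x \<xi>"
    and h: "continuous_on UNIV h" "(h has_derivative (\<lambda>v. n \<bullet> v)) (at x)" "h x = 0" "n \<noteq> 0"
    and sub: "{y. h y = 0} \<subseteq> H"
  shows "line_of \<xi> = line_of n"
proof -
  obtain U g G c where U: "local_defining H x U g G" and c: "\<xi> = c *\<^sub>R G x" and ne: "\<xi> \<noteq> 0"
    using \<xi> by (auto simp: conormal_def)
  have g: "(g has_derivative (\<lambda>v. G x \<bullet> v)) (at x)" and op: "open U" "x \<in> U"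
    and gU: "\<And>y. y \<in> U \<Longrightarrow> y \<in> H \<longleftrightarrow> g y = 0"
    using U by (auto simp: local_defining_def)
  obtain c' where "G x = c' *\<^sub>R n"
    using gradient_parallel[OF h g _ op] gU op h(3) sub by blast
  then have "\<xi> = (c * c') *\<^sub>R n" using c by simp
  then show ?thesis using ne line_of_scale[of "c * c'" n] by (cases "c * c' = 0") auto
qed

text \<open>A finite family of functions can be made pairwise either different or equal on a smaller
  open set; applied below to hypersurfaces that are graphs over a common base.\<close>

lemma finite_family_open_dichotomy:
  fixes N :: "'i \<Rightarrow> 'a::topological_space \<Rightarrow> 'b::t2_space"
  assumes "finite I" "\<And>i. continuous_on UNIV (N i)" "open W" "W \<noteq> {}"
  obtains W' where "W' \<subseteq> W" "open W'" "W' \<noteq> {}"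
    "\<And>i. i \<in> I \<Longrightarrow> (\<forall>y\<in>W'. N i y = N j y) \<or> (\<forall>y\<in>W'. N i y \<noteq> N j y)"
proof -
  have "\<exists>W'\<subseteq>W. open W' \<and> W' \<noteq> {} \<and> (\<forall>i\<in>I. (\<forall>y\<in>W'. N i y = N j y) \<or> (\<forall>y\<in>W'. N i y \<noteq> N j y))"
    using assms(1)
  proof induction
    case empty
    then show ?case using assms by auto
  next
    case (insert i I)
    then obtain V where V: "V \<subseteq> W" "open V" "V \<noteq> {}"
      "\<forall>i\<in>I. (\<forall>y\<in>V. N i y = N j y) \<or> (\<forall>y\<in>V. N i y \<noteq> N j y)" by blast
    show ?case
    proof (cases "\<forall>y\<in>V. N i y = N j y")
      case True
      then show ?thesis using V by (intro exI[of _ V]) auto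
    next
      case False
      have "open {y. N i y \<noteq> N j y}" by (rule open_Collect_neq[OF assms(2) assms(2)])
      then show ?thesis using V False by (intro exI[of _ "V \<inter> {y. N i y \<noteq> N j y}"]) auto
    qed
  qed
  then show thesis using that by blast
qed

section \<open>The smoothed arboreal hypersurface\<close>

locale smoothed_tree = rooted_tree \<rho> par P for \<rho> :: "'v::finite" and par P +
  fixes b b' :: "real \<Rightarrow> real" and f f1 f2 :: "real \<times> real \<Rightarrow> real"
    and h :: "'v \<Rightarrow> real^'v \<Rightarrow> real"
  assumes b_deriv: "t > 0 \<Longrightarrow> (b has_real_derivative b' t) (at t)"
    and b_nonpos: "t > 0 \<Longrightarrow> b t \<le> 0"
    and b_lim: "(b \<longlongrightarrow> 0) (at_right 0)"
    and f1_cont: "continuous_on UNIV f1" and f2_cont: "continuous_on UNIV f2"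
    and f_deriv: "(f has_derivative (\<lambda>(u, v). f1 p * u + f2 p * v)) (at p)"
    and f_submersion: "(f1 p, f2 p) \<noteq> (0, 0)"
    and f_zero: "f (x1, x2) = 0 \<longleftrightarrow> (x1 = 0 \<and> x2 \<ge> 0) \<or> (x1 > 0 \<and> x2 = b x1)"
    and f_pos: "f (x1, x2) > 0 \<longleftrightarrow> x1 > 0 \<and> x2 > b x1"
    and h_root: "h \<rho> x = x $ \<rho>"
    and h_step: "\<alpha> \<noteq> \<rho> \<Longrightarrow> h \<alpha> x = f (h (par \<alpha>) x, x $ \<alpha>)"
begin

text \<open>With this extension \<open>f (u, v)\<close> has the sign of
  \<open>min u (v - b0 u)\<close> for all \<open>u\<close> and \<open>v\<close>.\<close>

definition b0 :: "real \<Rightarrow> real" where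
  "b0 t = (if t > 0 then b t else 0)"

lemma isCont_b0: "isCont b0 t"
proof -
  consider "t < 0" | "t = 0" | "t > 0" by linarith
  then show ?thesis
  proof cases
    case 1
    then have "\<forall>\<^sub>F s in nhds t. b0 s = 0"
      by (intro eventually_nhds_in_open[of "{..<0}", THEN eventually_mono]) (auto simp: b0_def)
    then show ?thesis by (subst isCont_cong) auto
  next
    case 2
    have "(b0 \<longlongrightarrow> 0) (at_right 0)"
      by (rule Lim_transform_eventually[OF b_lim]) (auto simp: b0_def eventually_at_right_less eventually_at_filter)
    moreover have "(b0 \<longlongrightarrow> 0) (at_left 0)"
      by (rule tendsto_eventually) (auto simp: b0_def eventually_at_filter)
    ultimately show ?thesis using 2 by (simp add: isCont_def filterlim_split_at b0_def)
  next
    case 3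
    then have "\<forall>\<^sub>F s in nhds t. b0 s = b s"
      by (intro eventually_nhds_in_open[of "{0<..}", THEN eventually_mono]) (auto simp: b0_def)
    then show ?thesis using DERIV_isCont[OF b_deriv[OF 3]] isCont_cong by blast
  qed
qed

lemma continuous_b0: "continuous_on UNIV b0"
  by (simp add: continuous_at_imp_continuous_on isCont_b0)

section \<open>Partial derivatives of \<open>f\<close> along its zero set\<close>

lemma f_deriv_fst: "((\<lambda>s. f (s, y)) has_real_derivative f1 (x, y)) (at x)"
proof -
  have "((\<lambda>s. f (s, y)) has_derivative (\<lambda>s. case (s, 0) of (u, v) \<Rightarrow> f1 (x, y) * u + f2 (x, y) * v)) (at x)"
    by (rule has_derivative_compose[OF _ f_deriv]) (auto intro!: derivative_eq_intros)
  then show ?thesis by (simp add: has_field_derivative_def)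
qed

lemma f_deriv_snd: "((\<lambda>s. f (x, s)) has_real_derivative f2 (x, y)) (at y)"
proof -
  have "((\<lambda>s. f (x, s)) has_derivative (\<lambda>s. case (0, s) of (u, v) \<Rightarrow> f1 (x, y) * u + f2 (x, y) * v)) (at y)"
    by (rule has_derivative_compose[OF _ f_deriv]) (auto intro!: derivative_eq_intros)
  then show ?thesis by (simp add: has_field_derivative_def)
qed

lemma right_deriv_nonneg:
  assumes "(g has_real_derivative D) (at t)" "\<And>s. s > t \<Longrightarrow> g s \<ge> g t"
  shows "D \<ge> 0"
proof (rule ccontr)
  assume "\<not> D \<ge> 0"
  then obtain d where "d > 0" "\<forall>h>0. h < d \<longrightarrow> g (t + h) < g t"
    using DERIV_neg_dec_right[OF assms(1)] by auto
  then show False using assms(2)[of "t + d / 2"] by (auto dest: spec[of _ "d / 2"])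
qed

text \<open>Along the wall \<open>f\<close> stays \<open>0\<close> in the second variable, and to
  the right of it \<open>f\<close> is nonnegative because \<open>b \<le> 0\<close>. Submersivity
  then makes the first partial derivative positive.\<close>

lemma partials_on_wall:
  assumes "y \<ge> 0"
  shows "f2 (0, y) = 0" "f1 (0, y) > 0"
proof -
  have z: "f (0, s) = 0" if "s \<ge> y" for s using that assms by (simp add: f_zero)
  have "f2 (0, y) \<ge> 0"
    by (rule right_deriv_nonneg[OF f_deriv_snd]) (simp add: z)
  moreover have "- f2 (0, y) \<ge> 0"
    by (rule right_deriv_nonneg[OF DERIV_minus[OF f_deriv_snd]]) (simp add: z)
  ultimately show f2: "f2 (0, y) = 0" by simp
  have "f (s, y) \<ge> 0" if "s > 0" for s
    using f_pos[of s y] f_zero[of s y] b_nonpos[OF that] that assms by (cases "y = b s") auto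
  then have "f1 (0, y) \<ge> 0"
    by (intro right_deriv_nonneg[OF f_deriv_fst]) (simp add: z)
  moreover have "f1 (0, y) \<noteq> 0" using f_submersion[of "(0, y)"] f2 by simp
  ultimately show "f1 (0, y) > 0" by simp
qed

text \<open>\<open>f\<close> is positive above the graph, so \<open>f2 \<ge> 0\<close> there. If
  \<open>f2\<close> vanished, differentiating \<open>f (s, b s) = 0\<close> would make
  \<open>f1\<close> vanish as well, against submersivity.\<close>

lemma partial_on_graph:
  assumes "t > 0"
  shows "f2 (t, b t) > 0"
proof -
  have "f2 (t, b t) \<ge> 0"
  proof (rule right_deriv_nonneg[OF f_deriv_snd])
    show "f (t, s) \<ge> f (t, b t)" if "s > b t" for s
      using that assms f_pos[of t s] f_zero[of t "b t"] by auto
  qed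
  moreover have "f2 (t, b t) \<noteq> 0"
  proof
    assume f2: "f2 (t, b t) = 0"
    have "((\<lambda>s. f (s, b s)) has_derivative
        (\<lambda>s. case (s, b' t * s) of (u, v) \<Rightarrow> f1 (t, b t) * u + f2 (t, b t) * v)) (at t)"
      using b_deriv[OF assms]
      by (intro has_derivative_compose[OF _ f_deriv] has_derivative_Pair has_derivative_ident)
        (simp add: has_field_derivative_def)
    then have "((\<lambda>s. f (s, b s)) has_real_derivative f1 (t, b t)) (at t)"
      by (simp add: has_field_derivative_def f2)
    moreover have "((\<lambda>s. f (s, b s)) has_real_derivative 0) (at t)"
      by (rule has_field_derivative_transform_within_open[OF DERIV_const, of "{0<..}" _ 0])
        (use assms in \<open>auto simp: f_zero\<close>)
    ultimately have "f1 (t, b t) = 0" by (rule DERIV_unique)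
    then show False using f2 f_submersion by auto
  qed
  ultimately show ?thesis by simp
qed


text \<open>The coordinates \<open>x $ \<alpha> - b0 (h (par \<alpha>) x)\<close> turn \<open>{h \<alpha> \<ge> 0}\<close> into an orthant; \<open>m x \<alpha>\<close> is the
  minimum of those of them that belong to the path from \<open>\<rho>\<close> to \<open>\<alpha>\<close>.\<close>

definition m :: "real^'v \<Rightarrow> 'v \<Rightarrow> real" where
  "m x = tree_rec (x $ \<rho>) (\<lambda>\<alpha> r. min r (x $ \<alpha> - b0 (h (par \<alpha>) x)))"

section \<open>Coordinates in which the hypersurfaces are graphs\<close>

definition chart :: "real^'v \<Rightarrow> real^'v" where
  "chart x = (\<chi> \<alpha>. if \<alpha> = \<rho> then x $ \<rho> else x $ \<alpha> - b0 (h (par \<alpha>) x) - m x (par \<alpha>))"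

definition N :: "'v \<Rightarrow> real^'v \<Rightarrow> real" where
  "N \<alpha> y = tree_rec 0 (\<lambda>\<alpha> n. n + max 0 (- y $ \<alpha>)) \<alpha>"

text \<open>The value of \<open>h \<alpha>\<close> at \<open>unchart z\<close>. The entry of
  \<open>unchart\<close> is written out inside \<open>f\<close>, so that \<open>hval\<close> is
  defined first and \<open>unchart\<close> can refer to it.\<close>

definition hval :: "real^'v \<Rightarrow> 'v \<Rightarrow> real" where
  "hval z = tree_rec (z $ \<rho>) (\<lambda>\<alpha> e. f (e, z $ \<alpha> + (z $ \<rho> - N (par \<alpha>) z) + b0 e))"

definition unchart :: "real^'v \<Rightarrow> real^'v" where
  "unchart z = (\<chi> \<alpha>. if \<alpha> = \<rho> then z $ \<rho> else z $ \<alpha> + (z $ \<rho> - N (par \<alpha>) z) + b0 (hval z (par \<alpha>)))"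

lemma chart_root: "chart x $ \<rho> = x $ \<rho>"
  and chart_nth: "\<alpha> \<noteq> \<rho> \<Longrightarrow> chart x $ \<alpha> = x $ \<alpha> - b0 (h (par \<alpha>) x) - m x (par \<alpha>)"
  by (simp_all add: chart_def)

lemma unchart_root: "unchart z $ \<rho> = z $ \<rho>"
  and unchart_nth: "\<alpha> \<noteq> \<rho> \<Longrightarrow>
    unchart z $ \<alpha> = z $ \<alpha> + (z $ \<rho> - N (par \<alpha>) z) + b0 (hval z (par \<alpha>))"
  by (simp_all add: unchart_def)

lemma m_root: "m x \<rho> = x $ \<rho>"
  and m_step: "\<alpha> \<noteq> \<rho> \<Longrightarrow> m x \<alpha> = min (m x (par \<alpha>)) (x $ \<alpha> - b0 (h (par \<alpha>) x))"
  by (simp_all add: m_def tree_rec_root tree_rec_step)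

lemma N_root: "N \<rho> y = 0"
  and N_step: "\<alpha> \<noteq> \<rho> \<Longrightarrow> N \<alpha> y = N (par \<alpha>) y + max 0 (- y $ \<alpha>)"
  by (simp_all add: N_def tree_rec_root tree_rec_step)

lemma hval_root: "hval z \<rho> = z $ \<rho>"
  and hval_step: "\<alpha> \<noteq> \<rho> \<Longrightarrow> hval z \<alpha> = f (hval z (par \<alpha>), unchart z $ \<alpha>)"
  by (simp_all add: hval_def unchart_def tree_rec_root tree_rec_step)

lemma N_cong: "(\<And>\<gamma>. \<gamma> \<noteq> \<rho> \<Longrightarrow> y $ \<gamma> = y' $ \<gamma>) \<Longrightarrow> N \<alpha> y = N \<alpha> y'"
  by (induction \<alpha> rule: tree_induct) (auto simp: N_root N_step)

text \<open>Between the top of its component and \<open>\<alpha>\<close> all entries are nonnegative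
  and contribute no negative part.\<close>

lemma N_top_of: "N (top_of y \<alpha>) y = N \<alpha> y"
  by (induction \<alpha> rule: tree_induct) (auto simp: top_of_root top_of_step N_root N_step)

lemma h_unchart: "h \<alpha> (unchart z) = hval z \<alpha>"
  by (induction \<alpha> rule: tree_induct) (auto simp: h_root h_step hval_root hval_step unchart_root)

lemma m_unchart: "m (unchart z) \<alpha> = z $ \<rho> - N \<alpha> z"
  by (induction \<alpha> rule: tree_induct)
    (auto simp: m_root m_step N_root N_step h_unchart unchart_root unchart_nth min_def max_def)

lemma chart_unchart: "chart (unchart z) = z"
proof -
  have "chart (unchart z) $ \<alpha> = z $ \<alpha>" for \<alpha>
    by (cases "\<alpha> = \<rho>")
      (simp_all add: chart_root unchart_root chart_nth unchart_nth m_unchart h_unchart)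
  then show ?thesis by (simp add: vec_eq_iff)
qed

text \<open>By \<open>min r s = r - max 0 (r - s)\<close>, each drop of the running minimum is the
  negative part of the corresponding entry of \<open>chart x\<close>.\<close>

lemma m_chart: "m x \<alpha> = x $ \<rho> - N \<alpha> (chart x)"
proof (induction \<alpha> rule: tree_induct)
  case root
  show ?case by (simp add: m_root N_root)
next
  case (step \<alpha>)
  then show ?case by (simp add: m_step N_step chart_nth min_def max_def)
qed

lemma hval_chart: "hval (chart x) \<alpha> = h \<alpha> x"
proof (induction \<alpha> rule: tree_induct)
  case root
  show ?case by (simp add: hval_root h_root chart_root)
next
  case (step \<alpha>)
  have "unchart (chart x) $ \<alpha> = x $ \<alpha>"
    using step m_chart[of x "par \<alpha>"] by (simp add: unchart_nth chart_nth chart_root)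
  then show ?case using step by (simp add: hval_step h_step)
qed

lemma unchart_chart: "unchart (chart x) = x"
proof -
  have "unchart (chart x) $ \<alpha> = x $ \<alpha>" for \<alpha>
    using m_chart[of x "par \<alpha>"]
    by (cases "\<alpha> = \<rho>") (simp_all add: unchart_root unchart_nth hval_chart chart_nth chart_root)
  then show ?thesis by (simp add: vec_eq_iff)
qed

text \<open>By induction \<open>h (par \<alpha>) x\<close> may be replaced by
  \<open>m x (par \<alpha>)\<close> in the sign rule for \<open>f\<close>, and the minimum then
  taken is \<open>m x \<alpha>\<close>.\<close>

lemma h_sign: "(h \<alpha> x = 0 \<longleftrightarrow> m x \<alpha> = 0) \<and> (h \<alpha> x > 0 \<longleftrightarrow> m x \<alpha> > 0)"
proof (induction \<alpha> rule: tree_induct)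
  case root
  show ?case by (simp add: m_root h_root)
next
  case (step \<alpha>)
  let ?s = "x $ \<alpha> - b0 (h (par \<alpha>) x)"
  consider "h (par \<alpha>) x > 0" | "h (par \<alpha>) x = 0" | "h (par \<alpha>) x < 0" by linarith
  then show ?case
  proof cases
    case 1
    then have "m x (par \<alpha>) > 0" "?s = x $ \<alpha> - b (h (par \<alpha>) x)" using step by (auto simp: b0_def)
    then show ?thesis using 1 step(1)
      by (auto simp: h_step f_zero f_pos m_step min_def)
  next
    case 2
    then have "m x (par \<alpha>) = 0" "?s = x $ \<alpha>" using step by (auto simp: b0_def)
    then show ?thesis using 2 step(1)
      by (auto simp: h_step f_zero f_pos m_step min_def)
  next
    case 3
    then have "m x (par \<alpha>) < 0" using step by linarith
    then show ?thesis using 3 step(1)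
      by (auto simp: h_step f_zero f_pos m_step min_def)
  qed
qed

lemma h_zero_iff: "h \<alpha> x = 0 \<longleftrightarrow> x $ \<rho> = N \<alpha> (chart x)"
  using h_sign[of \<alpha> x] by (simp add: m_chart)

text \<open>The entry of \<open>y\<close> at \<open>\<rho>\<close> is overwritten by the height
  \<open>N \<alpha> y\<close>; only the other entries matter.\<close>

definition graph :: "'v \<Rightarrow> real^'v \<Rightarrow> real^'v" where
  "graph \<alpha> y = unchart (\<chi> \<gamma>. if \<gamma> = \<rho> then N \<alpha> y else y $ \<gamma>)"

lemma chart_graph: "chart (graph \<alpha> y) $ \<gamma> = (if \<gamma> = \<rho> then N \<alpha> y else y $ \<gamma>)"
  by (simp add: graph_def chart_unchart)

lemma N_chart_graph: "N \<beta> (chart (graph \<alpha> y)) = N \<beta> y"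
  by (rule N_cong) (simp add: chart_graph)

lemma h_graph: "h \<alpha> (graph \<alpha> y) = 0"
  using chart_graph[of \<alpha> y \<rho>] by (simp add: h_zero_iff N_chart_graph chart_root)

lemma graph_chart: "h \<alpha> x = 0 \<Longrightarrow> graph \<alpha> (chart x) = x"
proof -
  assume "h \<alpha> x = 0"
  then have "(\<chi> \<gamma>. if \<gamma> = \<rho> then N \<alpha> (chart x) else chart x $ \<gamma>) = chart x"
    by (simp add: h_zero_iff vec_eq_iff chart_root)
  then show ?thesis by (simp add: graph_def unchart_chart)
qed

lemma graph_cong: "(\<And>\<gamma>. \<gamma> \<noteq> \<rho> \<Longrightarrow> y $ \<gamma> = y' $ \<gamma>) \<Longrightarrow> graph \<alpha> y = graph \<alpha> y'"
  unfolding graph_def using N_cong[of y y' \<alpha>] by (intro arg_cong[of _ _ unchart]) (simp add: vec_eq_iff)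

section \<open>Gradients of the functions \<open>h \<alpha>\<close> and their rays\<close>

definition G :: "'v \<Rightarrow> real^'v \<Rightarrow> real^'v" where
  "G = tree_rec (\<lambda>x. axis \<rho> 1) (\<lambda>\<alpha> g x. f1 (h (par \<alpha>) x, x $ \<alpha>) *\<^sub>R g x + f2 (h (par \<alpha>) x, x $ \<alpha>) *\<^sub>R axis \<alpha> 1)"

lemma G_root: "G \<rho> x = axis \<rho> 1"
  and G_step: "\<alpha> \<noteq> \<rho> \<Longrightarrow>
    G \<alpha> x = f1 (h (par \<alpha>) x, x $ \<alpha>) *\<^sub>R G (par \<alpha>) x + f2 (h (par \<alpha>) x, x $ \<alpha>) *\<^sub>R axis \<alpha> 1"
  by (simp_all add: G_def tree_rec_root tree_rec_step)

lemma h_has_derivative: "(h \<alpha> has_derivative (\<lambda>v. G \<alpha> x \<bullet> v)) (at x)"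
proof (induction \<alpha> rule: tree_induct)
  case root
  have "((\<lambda>x. x $ \<rho>) has_derivative (\<lambda>v. v $ \<rho>)) (at x)"
    by (rule bounded_linear_imp_has_derivative[OF bounded_linear_vec_nth])
  then show ?case by (simp add: G_root inner_axis' h_root[abs_def])
next
  case (step \<alpha>)
  have "((\<lambda>x. (h (par \<alpha>) x, x $ \<alpha>)) has_derivative (\<lambda>v. (G (par \<alpha>) x \<bullet> v, v $ \<alpha>))) (at x)"
    by (intro has_derivative_Pair step bounded_linear_imp_has_derivative[OF bounded_linear_vec_nth])
  from has_derivative_compose[OF this f_deriv]
  show ?case using step(1) by (simp add: h_step[OF step(1), abs_def] G_step inner_add_left inner_axis')
qed

lemma continuous_h: "continuous_on UNIV (h \<alpha>)"
  by (intro continuous_at_imp_continuous_on ballI has_derivative_continuous[OF h_has_derivative])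

lemma continuous_G: "continuous_on UNIV (G \<alpha>)"
proof (induction \<alpha> rule: tree_induct)
  case root
  show ?case by (simp add: G_root[abs_def])
next
  case (step \<alpha>)
  have p: "continuous_on UNIV (\<lambda>x. (h (par \<alpha>) x, x $ \<alpha>))"
    by (intro continuous_on_Pair continuous_h continuous_on_component continuous_on_id)
  show ?case unfolding G_step[OF step(1), abs_def]
    by (intro continuous_on_add continuous_on_scaleR continuous_on_const step(2)
        continuous_on_compose2[OF f1_cont p] continuous_on_compose2[OF f2_cont p]) auto
qed

lemma G_outside: "\<gamma> \<notin> set (P \<alpha>) \<Longrightarrow> G \<alpha> x $ \<gamma> = 0"
  by (induction \<alpha> rule: tree_induct) (auto simp: G_root G_step P_root P_step axis_def)

text \<open>The gradient of the parent has no \<open>\<alpha>\<close> entry, so that of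
  \<open>\<alpha>\<close> can vanish only if \<open>f2 = 0\<close>; but then
  \<open>f1 \<noteq> 0\<close> and it is a nonzero multiple of the gradient of the parent.\<close>

lemma G_nonzero: "G \<alpha> x \<noteq> 0"
proof (induction \<alpha> rule: tree_induct)
  case root
  show ?case by (simp add: G_root)
next
  case (step \<alpha>)
  let ?p = "(h (par \<alpha>) x, x $ \<alpha>)"
  show ?case
  proof
    assume 0: "G \<alpha> x = 0"
    have "G \<alpha> x $ \<alpha> = f2 ?p" using step(1) by (simp add: G_step G_outside P_par)
    then have "f2 ?p = 0" using 0 by simp
    then have "f1 ?p *\<^sub>R G (par \<alpha>) x = 0" using 0 step(1) by (simp add: G_step)
    then show False using step(2) \<open>f2 ?p = 0\<close> f_submersion[of ?p] by simp
  qed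
qed

text \<open>The two branches of \<open>{f = 0}\<close> match the two cases of \<open>top_of\<close>.
  On the wall the chart entry is nonnegative, \<open>f2 = 0 < f1\<close>, and ray and top are
  inherited from the parent. On the graph of \<open>b\<close> the chart entry is
  \<open>- m x (par \<alpha>) < 0\<close>, so \<open>\<alpha>\<close> is its own top, with gradient
  entry \<open>f2 > 0\<close>.\<close>

lemma top_of_properties:
  assumes "h \<alpha> x = 0"
  shows "h (top_of (chart x) \<alpha>) x = 0" "ray_of (G \<alpha> x) = ray_of (G (top_of (chart x) \<alpha>) x)"
    "G (top_of (chart x) \<alpha>) x $ top_of (chart x) \<alpha> > 0"
proof -
  have "h (top_of (chart x) \<alpha>) x = 0 \<and> ray_of (G \<alpha> x) = ray_of (G (top_of (chart x) \<alpha>) x) \<and>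
    G (top_of (chart x) \<alpha>) x $ top_of (chart x) \<alpha> > 0" using assms
  proof (induction \<alpha> rule: tree_induct)
    case root
    then show ?case by (simp add: top_of_root G_root)
  next
    case (step \<alpha>)
    have "(h (par \<alpha>) x = 0 \<and> x $ \<alpha> \<ge> 0) \<or> (h (par \<alpha>) x > 0 \<and> x $ \<alpha> = b (h (par \<alpha>) x))"
      using step by (simp add: h_step f_zero)
    then show ?case
    proof
      assume 1: "h (par \<alpha>) x = 0 \<and> x $ \<alpha> \<ge> 0"
      then have "m x (par \<alpha>) = 0" using h_sign by blast
      then have "chart x $ \<alpha> \<ge> 0" using step(1) 1 by (simp add: chart_nth b0_def)
      then have t: "top_of (chart x) \<alpha> = top_of (chart x) (par \<alpha>)" using step(1) by (simp add: top_of_step)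
      have "G \<alpha> x = f1 (0, x $ \<alpha>) *\<^sub>R G (par \<alpha>) x" using step(1) 1 partials_on_wall[of "x $ \<alpha>"] by (simp add: G_step)
      then have "ray_of (G \<alpha> x) = ray_of (G (par \<alpha>) x)"
        using ray_of_scale partials_on_wall[of "x $ \<alpha>"] 1 by metis
      then show ?case using step 1 t by simp
    next
      assume 1: "h (par \<alpha>) x > 0 \<and> x $ \<alpha> = b (h (par \<alpha>) x)"
      then have "m x (par \<alpha>) > 0" using h_sign by blast
      then have "chart x $ \<alpha> < 0" using step(1) 1 by (simp add: chart_nth b0_def)
      then have t: "top_of (chart x) \<alpha> = \<alpha>" using step(1) by (simp add: top_of_step)
      have "G \<alpha> x $ \<alpha> = f2 (h (par \<alpha>) x, x $ \<alpha>)" using step(1) by (simp add: G_step G_outside P_par)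
      then show ?case using step t 1 partial_on_graph by simp
    qed
  qed
  then show "h (top_of (chart x) \<alpha>) x = 0" "ray_of (G \<alpha> x) = ray_of (G (top_of (chart x) \<alpha>) x)"
    "G (top_of (chart x) \<alpha>) x $ top_of (chart x) \<alpha> > 0" by blast+
qed

text \<open>If the lines agree, the gradient of each top has a nonzero entry at the other top. Each
  top then lies on the root path of the other, and so they coincide.\<close>

lemma line_G_eq_iff:
  assumes "h \<alpha> x = 0" "h \<beta> x = 0"
  shows "line_of (G \<alpha> x) = line_of (G \<beta> x) \<longleftrightarrow> top_of (chart x) \<alpha> = top_of (chart x) \<beta>"
proof
  let ?s = "top_of (chart x) \<alpha>" and ?t = "top_of (chart x) \<beta>"
  note s = top_of_properties[OF assms(1)] and t = top_of_properties[OF assms(2)]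
  assume "line_of (G \<alpha> x) = line_of (G \<beta> x)"
  then have "line_of (G ?s x) = line_of (G ?t x)"
    by (metis s(2) t(2) ray_line_ray_of)
  then obtain c where c: "c \<noteq> 0" "G ?s x = c *\<^sub>R G ?t x" by (rule line_of_eqD[OF _ G_nonzero])
  have "G ?t x $ ?s \<noteq> 0" using arg_cong[OF c(2), of "\<lambda>v. v $ ?s"] s(3) by auto
  moreover have "G ?s x $ ?t \<noteq> 0" using arg_cong[OF c(2), of "\<lambda>v. v $ ?t"] t(3) c(1) by auto
  ultimately show "?s = ?t" using G_outside P_antisym by metis
next
  assume "top_of (chart x) \<alpha> = top_of (chart x) \<beta>"
  then show "line_of (G \<alpha> x) = line_of (G \<beta> x)"
    using top_of_properties(2)[OF assms(1)] top_of_properties(2)[OF assms(2)] by (metis ray_line_ray_of)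
qed

text \<open>Equal lines mean a common top, whose ray is the ray of both; this makes the
  coorientation well defined where sheets touch.\<close>

lemma line_eq_imp_ray_eq:
  assumes "h \<alpha> x = 0" "h \<beta> x = 0" "line_of (G \<alpha> x) = line_of (G \<beta> x)"
  shows "ray_of (G \<alpha> x) = ray_of (G \<beta> x)"
  using assms line_G_eq_iff top_of_properties(2) by metis

section \<open>Continuity of the coordinates and the parametrizations\<close>

lemma continuous_N: "continuous_on UNIV (N \<alpha>)"
proof (induction \<alpha> rule: tree_induct)
  case root
  show ?case by (simp add: N_root[abs_def])
next
  case (step \<alpha>)
  then show ?case unfolding N_step[OF step(1), abs_def] by (intro continuous_intros)
qed

lemma continuous_f: "continuous_on UNIV f"
  by (intro continuous_at_imp_continuous_on ballI has_derivative_continuous[OF f_deriv])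

lemma continuous_m: "continuous_on UNIV (\<lambda>x. m x \<alpha>)"
proof (induction \<alpha> rule: tree_induct)
  case root
  show ?case unfolding m_root by (intro continuous_intros)
next
  case (step \<alpha>)
  show ?case unfolding m_step[OF step(1)]
    by (intro continuous_on_min continuous_on_diff continuous_on_compose2[OF continuous_b0 continuous_h] step
        continuous_on_component continuous_on_id) auto
qed

lemma continuous_chart: "continuous_on A chart"
proof -
  have "continuous_on UNIV (\<lambda>x. if \<alpha> = \<rho> then x $ \<rho> else x $ \<alpha> - b0 (h (par \<alpha>) x) - m x (par \<alpha>))" for \<alpha>
    by (cases "\<alpha> = \<rho>")
      (auto intro!: continuous_on_diff continuous_on_compose2[OF continuous_b0 continuous_h] continuous_m
        continuous_on_component continuous_on_id)
  then have "continuous_on UNIV chart" unfolding chart_def by (rule continuous_on_vec_lambda)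
  then show ?thesis by (rule continuous_on_subset) simp
qed

text \<open>\<open>unchart\<close> at \<open>\<alpha>\<close> needs \<open>hval\<close> at the
  parent, and \<open>hval\<close> at \<open>\<alpha>\<close> needs both; hence the conditional
  statement \<open>u\<close> inside the induction.\<close>

lemma continuous_unchart_component: "continuous_on UNIV (\<lambda>z. unchart z $ \<alpha>)"
proof -
  have u: "continuous_on UNIV (\<lambda>z. unchart z $ \<alpha>)" if "continuous_on UNIV (\<lambda>z. hval z (par \<alpha>))" for \<alpha>
    using that continuous_N[of "par \<alpha>"] unfolding unchart_def vec_lambda_beta
    by (cases "\<alpha> = \<rho>")
      (auto intro!: continuous_on_add continuous_on_diff continuous_on_compose2[OF continuous_b0]
        continuous_on_component continuous_on_id)
  have h: "continuous_on UNIV (\<lambda>z. hval z \<alpha>)" for \<alpha>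
  proof (induction \<alpha> rule: tree_induct)
    case root
    show ?case unfolding hval_root by (intro continuous_intros)
  next
    case (step \<alpha>)
    show ?case unfolding hval_step[OF step(1)]
      by (intro continuous_on_compose2[OF continuous_f continuous_on_Pair[OF step(2) u[OF step(2)]]]) auto
  qed
  show ?thesis by (rule u[OF h])
qed

lemma continuous_unchart: "continuous_on UNIV unchart"
proof -
  have "continuous_on UNIV (\<lambda>z. \<chi> \<alpha>. unchart z $ \<alpha>)"
    by (intro continuous_on_vec_lambda continuous_unchart_component)
  then show ?thesis by simp
qed

lemma continuous_graph: "continuous_on A (graph \<alpha>)"
proof -
  have "continuous_on UNIV (\<lambda>y. if \<gamma> = \<rho> then N \<alpha> y else y $ \<gamma>)" for \<gamma>
    using continuous_N by (cases "\<gamma> = \<rho>") (auto intro!: continuous_intros)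
  then have "continuous_on UNIV (\<lambda>y. \<chi> \<gamma>. if \<gamma> = \<rho> then N \<alpha> y else y $ \<gamma>)"
    by (rule continuous_on_vec_lambda)
  then have "continuous_on UNIV (graph \<alpha>)"
    unfolding graph_def by (rule continuous_on_compose2[OF continuous_unchart]) simp
  then show ?thesis by (rule continuous_on_subset) simp
qed

subsection \<open>The coline bundle\<close>

abbreviation hyp :: "'v \<Rightarrow> (real^'v) set" where
  "hyp \<alpha> \<equiv> {x. h \<alpha> x = 0}"

abbreviation lines :: "'v \<Rightarrow> ((real^'v) \<times> (real^'v) set) set" where
  "lines \<alpha> \<equiv> (\<lambda>x. (x, line_of (G \<alpha> x))) ` hyp \<alpha>"

lemma local_defining_h:
  assumes "open U" "x \<in> U" "H \<inter> U = {y \<in> U. h \<alpha> y = 0}"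
  shows "local_defining H x U (h \<alpha>) (G \<alpha>)"
  using assms continuous_on_subset[OF continuous_G] h_has_derivative G_nonzero
  by (auto simp: local_defining_def)

lemma conormal_G:
  assumes "open U" "x \<in> U" "H \<inter> U = {y \<in> U. h \<alpha> y = 0}" "h \<alpha> x = 0"
  shows "conormal H x (G \<alpha> x)"
proof -
  have "x \<in> H" using assms by blast
  moreover have "G \<alpha> x = 1 *\<^sub>R G \<alpha> x" by simp
  ultimately show ?thesis
    using local_defining_h[OF assms(1-3)] G_nonzero[of \<alpha> x] unfolding conormal_def by blast
qed

text \<open>Moving slightly in the base reaches an open set over which each height
  \<open>N \<beta>\<close> either equals \<open>N \<alpha>\<close> throughout or differs from it
  everywhere. Near the graph of \<open>N \<alpha>\<close> over that set the union is just
  \<open>hyp \<alpha>\<close>.\<close>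

lemma conormal_dense:
  assumes "h \<alpha> x = 0" "open V" "x \<in> V"
  shows "\<exists>x'\<in>V. h \<alpha> x' = 0 \<and> conormal (\<Union>\<beta>. hyp \<beta>) x' (G \<alpha> x')"
proof -
  have "open (graph \<alpha> -` V)" using assms(2) continuous_graph by (rule open_vimage)
  moreover have "chart x \<in> graph \<alpha> -` V" using assms graph_chart by simp
  ultimately obtain W where W: "W \<subseteq> graph \<alpha> -` V" "open W" "W \<noteq> {}"
    "\<And>\<beta>. (\<forall>y\<in>W. N \<beta> y = N \<alpha> y) \<or> (\<forall>y\<in>W. N \<beta> y \<noteq> N \<alpha> y)"
    using finite_family_open_dichotomy[of UNIV N "graph \<alpha> -` V" \<alpha>] continuous_N by auto
  obtain y where y: "y \<in> W" using W(3) by blast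
  define x' where "x' = graph \<alpha> y"
  \<comment> \<open>Forgets the height; freezing the entry at \<open>\<rho>\<close> to
    \<open>y $ \<rho>\<close> gives \<open>base x' = y\<close>.\<close>
  define base where "base X = (\<chi> \<gamma>. if \<gamma> = \<rho> then y $ \<rho> else chart X $ \<gamma>)" for X
  define B where "B = {\<beta>. \<forall>y\<in>W. N \<beta> y \<noteq> N \<alpha> y}"
  \<comment> \<open>Over \<open>W\<close>, removing the sheets of different height leaves only those
    that coincide with the sheet of \<open>\<alpha>\<close>.\<close>
  define U where "U = base -` W \<inter> (\<Inter>\<beta>\<in>B. {X. h \<beta> X \<noteq> 0})"
  have "continuous_on UNIV (\<lambda>X. if \<gamma> = \<rho> then y $ \<rho> else chart X $ \<gamma>)" for \<gamma>
    using continuous_chart by (cases "\<gamma> = \<rho>") (auto intro!: continuous_intros)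
  then have "continuous_on UNIV base" unfolding base_def by (rule continuous_on_vec_lambda)
  then have "open (base -` W)" by (rule open_vimage[OF W(2)])
  moreover have "open (\<Inter>\<beta>\<in>B. {X. h \<beta> X \<noteq> 0})"
    by (intro open_INT ballI open_Collect_neq continuous_h continuous_on_const) simp
  ultimately have op: "open U" unfolding U_def by (rule open_Int)
  have "base x' = y" by (simp add: base_def x'_def chart_graph vec_eq_iff)
  moreover have "h \<beta> x' \<noteq> 0" if "\<beta> \<in> B" for \<beta>
    using that y chart_graph[of \<alpha> y \<rho>] by (auto simp: B_def h_zero_iff x'_def N_chart_graph chart_root)
  ultimately have xU: "x' \<in> U" using y by (auto simp: U_def)
  have N_base: "N \<beta> (base X) = N \<beta> (chart X)" for \<beta> X
    by (rule N_cong) (simp add: base_def)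
  have "h \<alpha> X = 0" if "X \<in> U" "h \<beta> X = 0" for X \<beta>
  proof -
    have "\<beta> \<notin> B" using that by (auto simp: U_def)
    then have "\<forall>y\<in>W. N \<beta> y = N \<alpha> y" using W(4)[of \<beta>] unfolding B_def by blast
    then have "N \<beta> (base X) = N \<alpha> (base X)" using that(1) by (auto simp: U_def)
    then show ?thesis using that(2) by (simp add: h_zero_iff N_base)
  qed
  then have "(\<Union>\<beta>. hyp \<beta>) \<inter> U = {X \<in> U. h \<alpha> X = 0}" by blast
  then have "conormal (\<Union>\<beta>. hyp \<beta>) x' (G \<alpha> x')"
    using conormal_G[OF op xU] h_graph by (simp add: x'_def)
  moreover have "x' \<in> V" using W(1) y by (auto simp: x'_def)
  ultimately show ?thesis using h_graph by (auto simp: x'_def)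
qed

lemma closed_hyp: "closed (hyp \<alpha>)"
  by (intro closed_Collect_eq continuous_h continuous_on_const)

lemma closedin_lines: "closedin PstarM (lines \<alpha>)"
  by (rule closedin_PstarM_lines[OF continuous_G G_nonzero closed_hyp])

lemma continuous_map_lines: "continuous_map euclidean PstarM (\<lambda>x. (x, line_of (G \<alpha> x)))"
  using continuous_map_line_of[OF continuous_G G_nonzero] by (simp add: subtopology_UNIV)

lemma continuous_map_rays: "continuous_map euclidean SstarM (\<lambda>x. (x, ray_of (G \<alpha> x)))"
  using continuous_map_ray_of[OF continuous_G G_nonzero] by (simp add: subtopology_UNIV)

text \<open>\<open>L\<close> is used as \<open>line_of\<close> and as \<open>ray_of\<close>. A
  neighbourhood in the bundle pulls back along the section to an open set of base points, where
  density applies.\<close>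

lemma conormal_dense_closure:
  assumes q: "continuous_map euclidean X (\<lambda>x. (x, L (G \<alpha> x)))" and x: "h \<alpha> x = 0"
  shows "(x, L (G \<alpha> x)) \<in> X closure_of {(x, L \<xi>) | x \<xi>. conormal (\<Union>\<beta>. hyp \<beta>) x \<xi>}"
  unfolding in_closure_of
proof (intro conjI allI impI)
  show "(x, L (G \<alpha> x)) \<in> topspace X" using q by (auto simp: continuous_map_def)
  fix T assume T: "(x, L (G \<alpha> x)) \<in> T \<and> openin X T"
  have "open {x. (x, L (G \<alpha> x)) \<in> T}"
    using openin_continuous_map_preimage[OF q, of T] T by simp
  from conormal_dense[OF x this] T
  show "\<exists>y. y \<in> {(x, L \<xi>) | x \<xi>. conormal (\<Union>\<beta>. hyp \<beta>) x \<xi>} \<and> y \<in> T" by blast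
qed

text \<open>The finitely many sets \<open>lines \<alpha>\<close> are closed and contain all conormal
  lines at smooth points; conversely such lines are dense in each of them.\<close>

lemma coline_bundle_union: "coline_bundle (\<Union>\<alpha>. hyp \<alpha>) = (\<Union>\<alpha>. lines \<alpha>)"
proof
  show "coline_bundle (\<Union>\<alpha>. hyp \<alpha>) \<subseteq> (\<Union>\<alpha>. lines \<alpha>)"
    unfolding coline_bundle_def
  proof (rule closure_of_minimal)
    show "closedin PstarM (\<Union>\<alpha>. lines \<alpha>)" by (intro closedin_Union) (auto simp: closedin_lines)
    show "conormal_lines (\<Union>\<alpha>. hyp \<alpha>) \<subseteq> (\<Union>\<alpha>. lines \<alpha>)"
    proof
      fix p assume "p \<in> conormal_lines (\<Union>\<alpha>. hyp \<alpha>)"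
      then obtain x \<xi> where p: "p = (x, line_of \<xi>)" "conormal (\<Union>\<alpha>. hyp \<alpha>) x \<xi>"
        by (auto simp: conormal_lines_def)
      then obtain \<alpha> where \<alpha>: "h \<alpha> x = 0" by (auto simp: conormal_def)
      have "line_of \<xi> = line_of (G \<alpha> x)"
        by (rule conormal_imp_line[OF p(2) continuous_h h_has_derivative \<alpha> G_nonzero]) blast
      then show "p \<in> (\<Union>\<alpha>. lines \<alpha>)" using p \<alpha> by blast
    qed
  qed
  show "(\<Union>\<alpha>. lines \<alpha>) \<subseteq> coline_bundle (\<Union>\<alpha>. hyp \<alpha>)"
    using conormal_dense_closure[OF continuous_map_lines]
    by (auto simp: coline_bundle_def conormal_lines_def)
qed

text \<open>\<open>h \<alpha>\<close> is a global defining function, so the conormal lines already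
  form a closed set.\<close>

lemma coline_bundle_hyp: "coline_bundle (hyp \<alpha>) = lines \<alpha>"
proof -
  have "conormal_lines (hyp \<alpha>) = lines \<alpha>"
  proof
    show "conormal_lines (hyp \<alpha>) \<subseteq> lines \<alpha>"
    proof
      fix p assume "p \<in> conormal_lines (hyp \<alpha>)"
      then obtain x \<xi> where p: "p = (x, line_of \<xi>)" "conormal (hyp \<alpha>) x \<xi>"
        by (auto simp: conormal_lines_def)
      then have \<alpha>: "h \<alpha> x = 0" by (auto simp: conormal_def)
      have "line_of \<xi> = line_of (G \<alpha> x)"
        by (rule conormal_imp_line[OF p(2) continuous_h h_has_derivative \<alpha> G_nonzero]) blast
      then show "p \<in> lines \<alpha>" using p \<alpha> by blast
    qed
    show "lines \<alpha> \<subseteq> conormal_lines (hyp \<alpha>)"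
      using conormal_G[OF open_UNIV UNIV_I, of "hyp \<alpha>" \<alpha>] by (auto simp: conormal_lines_def)
  qed
  then show ?thesis by (simp add: coline_bundle_def closure_of_closedin closedin_lines)
qed

section \<open>The coorientation\<close>

definition \<sigma> :: "(real^'v) \<times> (real^'v) set \<Rightarrow> (real^'v) \<times> (real^'v) set" where
  "\<sigma> p = (fst p, ray_of (G (SOME \<alpha>. h \<alpha> (fst p) = 0 \<and> snd p = line_of (G \<alpha> (fst p))) (fst p)))"

text \<open>The chosen sheet may differ from \<open>\<alpha>\<close>, but sheets through
  \<open>x\<close> with the same line have the same ray.\<close>

lemma \<sigma>_line:
  assumes "h \<alpha> x = 0"
  shows "\<sigma> (x, line_of (G \<alpha> x)) = (x, ray_of (G \<alpha> x))"
proof -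
  let ?\<beta> = "SOME \<beta>. h \<beta> x = 0 \<and> line_of (G \<alpha> x) = line_of (G \<beta> x)"
  have "h ?\<beta> x = 0 \<and> line_of (G \<alpha> x) = line_of (G ?\<beta> x)"
    by (rule someI[of _ \<alpha>]) (simp add: assms)
  then have "ray_of (G \<alpha> x) = ray_of (G ?\<beta> x)" using line_eq_imp_ray_eq assms by blast
  then show ?thesis by (simp add: \<sigma>_def)
qed

text \<open>Pasting over the finite closed cover by the sets \<open>lines \<alpha>\<close>, on each
  of which the coorientation is given by the ray of \<open>G \<alpha>\<close>.\<close>

lemma coorientation_\<sigma>: "coorientation (\<Union>\<alpha>. hyp \<alpha>) \<sigma>"
proof -
  let ?H = "\<Union>\<alpha>. hyp \<alpha>"
  have top: "topspace (subtopology PstarM (coline_bundle ?H)) = (\<Union>\<alpha>. lines \<alpha>)"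
    using closedin_subset[OF closedin_lines] by (auto simp: coline_bundle_union)
  have "continuous_map (subtopology PstarM (coline_bundle ?H)) SstarM \<sigma>"
  proof (rule pasting_lemma_closed[where I = UNIV and T = lines and f = "\<lambda>\<alpha> p. (fst p, ray_of (G \<alpha> (fst p)))"])
    show "closedin (subtopology PstarM (coline_bundle ?H)) (lines \<alpha>)" for \<alpha>
      by (rule closedin_subset_topspace[OF closedin_lines]) (auto simp: coline_bundle_union)
    show "continuous_map (subtopology (subtopology PstarM (coline_bundle ?H)) (lines \<alpha>)) SstarM
        (\<lambda>p. (fst p, ray_of (G \<alpha> (fst p))))" for \<alpha>
      using continuous_map_compose[OF continuous_map_fst_PstarM continuous_map_rays]
      by (intro continuous_map_from_subtopology) (simp add: o_def)
    show "(fst p, ray_of (G \<alpha> (fst p))) = (fst p, ray_of (G \<beta> (fst p)))"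
      if "p \<in> topspace (subtopology PstarM (coline_bundle ?H)) \<inter> lines \<alpha> \<inter> lines \<beta>" for \<alpha> \<beta> p
    proof -
      have "p \<in> lines \<alpha>" "p \<in> lines \<beta>" using that by blast+
      then obtain x where "p = (x, line_of (G \<alpha> x))" "h \<alpha> x = 0" "h \<beta> x = 0"
        "line_of (G \<alpha> x) = line_of (G \<beta> x)" by auto
      then show ?thesis using line_eq_imp_ray_eq[of \<alpha> x \<beta>] by simp
    qed
    show "\<exists>\<alpha>. \<alpha> \<in> UNIV \<and> p \<in> lines \<alpha> \<and> \<sigma> p = (fst p, ray_of (G \<alpha> (fst p)))"
      if "p \<in> topspace (subtopology PstarM (coline_bundle ?H))" for p
      using that \<sigma>_line unfolding top by auto
  qed simp
  moreover have "\<sigma> p \<in> coray_bundle ?H" if "p \<in> (\<Union>\<alpha>. lines \<alpha>)" for p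
    using that conormal_dense_closure[OF continuous_map_rays] \<sigma>_line
    by (auto simp: coray_bundle_def conormal_rays_def)
  moreover have "ray_to_line (\<sigma> p) = p" if "p \<in> (\<Union>\<alpha>. lines \<alpha>)" for p
    using that \<sigma>_line by (auto simp: ray_to_line_def ray_line_ray_of)
  ultimately show ?thesis
    unfolding coorientation_def continuous_map_in_subtopology top coline_bundle_union[symmetric]
    by (auto simp: coline_bundle_union)
qed

lemma gradient_unique:
  assumes "(h \<alpha> has_derivative (\<lambda>v. \<xi> \<bullet> v)) (at x)"
  shows "\<xi> = G \<alpha> x"
proof -
  have "(\<lambda>v. \<xi> \<bullet> v) = (\<lambda>v. G \<alpha> x \<bullet> v)"
    by (rule has_derivative_unique[OF assms h_has_derivative])
  then have "(\<xi> - G \<alpha> x) \<bullet> (\<xi> - G \<alpha> x) = 0"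
    by (metis inner_diff_left right_minus_eq)
  then show ?thesis by simp
qed

section \<open>The homeomorphism from the arboreal singularity\<close>

definition emb :: "'v \<Rightarrow> real^'v \<Rightarrow> real^'v" where
  "emb \<alpha> x = graph \<alpha> (to_edge \<alpha> x)"

definition unembed :: "'v \<Rightarrow> real^'v \<Rightarrow> real^'v" where
  "unembed \<alpha> X = from_edge \<alpha> (\<chi> \<gamma>. if \<gamma> = \<rho> then 0 else chart X $ \<gamma>)"

text \<open>The map on the disjoint union of the copies that descends to the homeomorphism.\<close>

definition \<Psi> :: "'v \<times> (real^'v) \<Rightarrow> (real^'v) \<times> (real^'v) set" where
  "\<Psi> p = (emb (fst p) (snd p), line_of (G (fst p) (emb (fst p) (snd p))))"

lemma continuous_emb: "continuous_on A (emb \<alpha>)"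
  unfolding emb_def by (rule continuous_on_compose2[OF continuous_graph[of UNIV] continuous_to_edge]) simp

lemma continuous_unembed: "continuous_on A (unembed \<alpha>)"
proof -
  have "continuous_on A (\<lambda>X. if \<gamma> = \<rho> then 0 else chart X $ \<gamma>)" for \<gamma>
    using continuous_chart by (cases "\<gamma> = \<rho>") (auto intro!: continuous_intros)
  then have "continuous_on A (\<lambda>X. \<chi> \<gamma>. if \<gamma> = \<rho> then 0 else chart X $ \<gamma>)"
    by (rule continuous_on_vec_lambda)
  then show ?thesis unfolding unembed_def
    by (rule continuous_on_compose2[OF continuous_from_edge[of UNIV]]) simp
qed

lemma h_embed: "h \<alpha> (emb \<alpha> x) = 0"
  by (simp add: emb_def h_graph)

lemma unembed_in_copy: "unembed \<alpha> X \<in> arb_copy \<alpha>"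
  by (simp add: unembed_def from_edge_in_copy)

lemma chart_emb: "x \<in> arb_copy \<alpha> \<Longrightarrow>
    (\<chi> \<gamma>. if \<gamma> = \<rho> then 0 else chart (emb \<alpha> x) $ \<gamma>) = to_edge \<alpha> x"
  by (simp add: emb_def chart_graph vec_eq_iff to_edge_root arb_copy_def)

lemma unembed_embed: "x \<in> arb_copy \<alpha> \<Longrightarrow> unembed \<alpha> (emb \<alpha> x) = x"
  by (simp only: unembed_def chart_emb from_to_edge)

lemma embed_unembed:
  assumes "h \<alpha> X = 0"
  shows "emb \<alpha> (unembed \<alpha> X) = X"
proof -
  have "graph \<alpha> (\<chi> \<gamma>. if \<gamma> = \<rho> then 0 else chart X $ \<gamma>) = graph \<alpha> (chart X)"
    by (rule graph_cong) simp
  then show ?thesis using graph_chart[OF assms] by (simp add: emb_def unembed_def)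
qed

lemma top_of_chart_emb:
  "top_of (chart (emb \<alpha> x)) \<beta> = top_of (to_edge \<alpha> x) \<beta>"
  by (rule top_of_cong) (simp add: emb_def chart_graph)

text \<open>The criterion is that of \<open>arb_class_eq_iff\<close>, so \<open>\<Psi>\<close> and
  \<open>arb_class E\<close> have the same fibres. The base point determines the edge coordinates
  through \<open>chart\<close>, and the line determines the top.\<close>

lemma \<Psi>_eq_iff:
  assumes "x \<in> arb_copy \<alpha>" "y \<in> arb_copy \<beta>"
  shows "\<Psi> (\<alpha>, x) = \<Psi> (\<beta>, y) \<longleftrightarrow>
    to_edge \<alpha> x = to_edge \<beta> y \<and> top_of (to_edge \<alpha> x) \<alpha> = top_of (to_edge \<alpha> x) \<beta>"
proof
  assume \<Psi>: "\<Psi> (\<alpha>, x) = \<Psi> (\<beta>, y)"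
  then have eq: "emb \<alpha> x = emb \<beta> y" by (simp add: \<Psi>_def)
  have line: "line_of (G \<alpha> (emb \<alpha> x)) = line_of (G \<beta> (emb \<alpha> x))"
    unfolding eq using \<Psi> eq by (simp add: \<Psi>_def)
  have "to_edge \<alpha> x = to_edge \<beta> y"
    by (rule trans[OF chart_emb[OF assms(1), unfolded eq, symmetric] chart_emb[OF assms(2)]])
  moreover have "h \<beta> (emb \<alpha> x) = 0" using h_embed eq by metis
  then have "top_of (to_edge \<alpha> x) \<alpha> = top_of (to_edge \<alpha> x) \<beta>"
    using line_G_eq_iff[OF h_embed[of \<alpha> x], of \<beta>] line by (simp add: top_of_chart_emb)
  ultimately show "to_edge \<alpha> x = to_edge \<beta> y \<and> top_of (to_edge \<alpha> x) \<alpha> = top_of (to_edge \<alpha> x) \<beta>" ..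
next
  assume a: "to_edge \<alpha> x = to_edge \<beta> y \<and> top_of (to_edge \<alpha> x) \<alpha> = top_of (to_edge \<alpha> x) \<beta>"
  \<comment> \<open>Equal tops force equal heights, hence the same base point.\<close>
  then have "N \<alpha> (to_edge \<alpha> x) = N \<beta> (to_edge \<alpha> x)" using N_top_of by metis
  then have eq: "emb \<alpha> x = emb \<beta> y" using a by (simp add: emb_def graph_def cong: if_cong)
  then have "h \<beta> (emb \<alpha> x) = 0" using h_embed by metis
  then have "line_of (G \<alpha> (emb \<alpha> x)) = line_of (G \<beta> (emb \<alpha> x))"
    using line_G_eq_iff[OF h_embed[of \<alpha> x], of \<beta>] conjunct2[OF a] by (simp add: top_of_chart_emb)
  then show "\<Psi> (\<alpha>, x) = \<Psi> (\<beta>, y)" using eq by (simp add: \<Psi>_def)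
qed

lemma topspace_arb_disjoint_union: "topspace arb_disjoint_union = Sigma UNIV arb_copy"
  by (auto simp: arb_disjoint_union_def)

lemma image_embed: "emb \<alpha> ` arb_copy \<alpha> = hyp \<alpha>"
proof (intro equalityI subsetI)
  fix X assume "X \<in> hyp \<alpha>"
  then have "X = emb \<alpha> (unembed \<alpha> X)" by (simp add: embed_unembed)
  then show "X \<in> emb \<alpha> ` arb_copy \<alpha>" using unembed_in_copy by (rule image_eqI)
qed (auto simp: h_embed)

lemma \<Psi>_image: "\<Psi> ` topspace arb_disjoint_union = (\<Union>\<alpha>. lines \<alpha>)"
proof -
  have "\<Psi> ` topspace arb_disjoint_union = (\<Union>\<alpha>. (\<lambda>X. (X, line_of (G \<alpha> X))) ` (emb \<alpha> ` arb_copy \<alpha>))"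
    by (force simp: topspace_arb_disjoint_union \<Psi>_def)
  then show ?thesis by (simp only: image_embed)
qed

text \<open>A continuous closed surjection is a quotient map. Closedness holds copy by copy, and
  there are finitely many copies.\<close>

lemma quotient_map_\<Psi>:
  "quotient_map arb_disjoint_union (subtopology PstarM (coline_bundle (\<Union>\<alpha>. hyp \<alpha>))) \<Psi>"
proof (rule continuous_closed_imp_quotient_map)
  let ?Y = "subtopology PstarM (coline_bundle (\<Union>\<alpha>. hyp \<alpha>))"
  have top: "topspace ?Y = (\<Union>\<alpha>. lines \<alpha>)"
    using closedin_subset[OF closedin_lines] by (auto simp: coline_bundle_union)
  show "\<Psi> ` topspace arb_disjoint_union = topspace ?Y" by (simp only: \<Psi>_image top)
  have "continuous_map arb_disjoint_union PstarM \<Psi>"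
    unfolding continuous_map_def
  proof (intro conjI allI impI)
    show "\<Psi> \<in> topspace arb_disjoint_union \<rightarrow> topspace PstarM"
      unfolding image_subset_iff_funcset[symmetric] \<Psi>_image
      using closedin_subset[OF closedin_lines] by blast
    fix T :: "((real^'v) \<times> (real^'v) set) set"
    assume T: "openin PstarM T"
    have "openin (top_of_set (arb_copy \<alpha>)) {x. (\<alpha>, x) \<in> {p \<in> topspace arb_disjoint_union. \<Psi> p \<in> T}}" for \<alpha> :: 'v
    proof -
      have "continuous_map (top_of_set (arb_copy \<alpha>)) euclidean (emb \<alpha>)"
        using continuous_emb by simp
      from openin_continuous_map_preimage[OF continuous_map_compose[OF this continuous_map_lines] T]
      show ?thesis by (simp add: topspace_arb_disjoint_union \<Psi>_def)
    qed
    then show "openin arb_disjoint_union {p \<in> topspace arb_disjoint_union. \<Psi> p \<in> T}"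
      unfolding arb_disjoint_union_def openin_sum_topology by auto
  qed
  then show "continuous_map arb_disjoint_union ?Y \<Psi>"
    unfolding continuous_map_in_subtopology coline_bundle_union image_subset_iff_funcset[symmetric]
    by (simp add: \<Psi>_image)
  show "closed_map arb_disjoint_union ?Y \<Psi>"
    unfolding closed_map_def
  proof (intro allI impI)
    fix K :: "('v \<times> (real^'v)) set"
    assume K: "closedin arb_disjoint_union K"
    define S where "S \<alpha> = {x. (\<alpha>, x) \<in> K}" for \<alpha>
    have sub: "S \<alpha> \<subseteq> arb_copy \<alpha>" for \<alpha>
      using closedin_subset[OF K] by (auto simp: S_def topspace_arb_disjoint_union)
    have "closed (arb_copy \<alpha>)" for \<alpha> :: 'v
      unfolding arb_copy_def by (intro closed_Collect_eq continuous_intros)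
    moreover have "closedin (top_of_set (arb_copy \<alpha>)) (S \<alpha>)" for \<alpha>
      using K by (simp add: arb_disjoint_union_def closedin_sum_topology S_def)
    ultimately have S: "closed (S \<alpha>)" for \<alpha> by (rule closedin_closed_trans[rotated])
    \<comment> \<open>Written as a preimage under the continuous inverse, the image is visibly
      closed.\<close>
    have e: "emb \<alpha> ` S \<alpha> = hyp \<alpha> \<inter> unembed \<alpha> -` S \<alpha>" for \<alpha>
    proof (intro equalityI subsetI)
      fix X assume "X \<in> emb \<alpha> ` S \<alpha>"
      then show "X \<in> hyp \<alpha> \<inter> unembed \<alpha> -` S \<alpha>" using sub h_embed by (auto simp: unembed_embed subset_iff)
    next
      fix X assume "X \<in> hyp \<alpha> \<inter> unembed \<alpha> -` S \<alpha>"
      then show "X \<in> emb \<alpha> ` S \<alpha>" using embed_unembed by (metis (mono_tags) IntE image_eqI mem_Collect_eq vimage_eq)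
    qed
    have "closed (emb \<alpha> ` S \<alpha>)" for \<alpha>
      unfolding e by (intro closed_Int closed_hyp closed_vimage[OF S continuous_unembed])
    then have "closedin PstarM ((\<lambda>X. (X, line_of (G \<alpha> X))) ` (emb \<alpha> ` S \<alpha>))" for \<alpha>
      by (rule closedin_PstarM_lines[OF continuous_G G_nonzero])
    then have closed: "closedin PstarM (\<Union>\<alpha>. (\<lambda>X. (X, line_of (G \<alpha> X))) ` (emb \<alpha> ` S \<alpha>))"
      by (intro closedin_Union) auto
    have im: "\<Psi> ` K = (\<Union>\<alpha>. (\<lambda>X. (X, line_of (G \<alpha> X))) ` (emb \<alpha> ` S \<alpha>))"
      by (force simp: S_def \<Psi>_def)
    have "\<Psi> ` K \<subseteq> coline_bundle (\<Union>\<alpha>. hyp \<alpha>)"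
      unfolding coline_bundle_union \<Psi>_image[symmetric] using closedin_subset[OF K] by blast
    then show "closedin ?Y (\<Psi> ` K)"
      using closedin_subset_topspace[OF closed[folded im]] by blast
  qed
qed

text \<open>Two quotient maps with the same fibres have homeomorphic targets. On the piece of
  \<open>\<alpha>\<close> the composite with the projection is \<open>emb \<alpha>\<close>, with
  inverse induced by \<open>unembed \<alpha>\<close>.\<close>

lemma arboreal_homeomorphism:
  assumes E: "E = {{\<alpha>, par \<alpha>} | \<alpha>. \<alpha> \<noteq> \<rho>}"
  shows "\<exists>\<phi>. homeomorphic_map (arboreal E) (subtopology PstarM (coline_bundle (\<Union>\<alpha>. hyp \<alpha>))) \<phi> \<and>
    (\<forall>\<alpha>. homeomorphic_map (subtopology (arboreal E) (arboreal_piece E \<alpha>)) (top_of_set (hyp \<alpha>)) (fst \<circ> \<phi>))"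
proof -
  let ?Y = "subtopology PstarM (coline_bundle (\<Union>\<alpha>. hyp \<alpha>))"
  have q: "quotient_map arb_disjoint_union (arboreal E) (arb_class E)"
    unfolding arboreal_def by (rule quotient_map_quotient_topology)
  have fib: "arb_class E p = arb_class E p' \<longleftrightarrow> \<Psi> p = \<Psi> p'"
    if "p \<in> topspace arb_disjoint_union" "p' \<in> topspace arb_disjoint_union" for p p'
    using that arb_class_eq_iff[OF E] \<Psi>_eq_iff
    by (cases p, cases p') (simp add: topspace_arb_disjoint_union)
  obtain \<phi> where \<phi>: "continuous_map (arboreal E) ?Y \<phi>"
    "\<And>p. p \<in> topspace arb_disjoint_union \<Longrightarrow> \<phi> (arb_class E p) = \<Psi> p"
    using quotient_map_lift_exists[OF q quotient_imp_continuous_map[OF quotient_map_\<Psi>]] fib by metis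
  have "quotient_map arb_disjoint_union ?Y (\<phi> \<circ> arb_class E)"
    by (rule quotient_map_eq[OF quotient_map_\<Psi>]) (simp add: \<phi>(2))
  then have "quotient_map (arboreal E) ?Y \<phi>"
    by (rule quotient_map_from_composition[OF quotient_imp_continuous_map[OF q] \<phi>(1)])
  moreover have "inj_on \<phi> (topspace (arboreal E))"
    unfolding quotient_imp_surjective_map[OF q, symmetric] using fib \<phi>(2) by (auto simp: inj_on_def)
  ultimately have hom: "homeomorphic_map (arboreal E) ?Y \<phi>" by (simp add: homeomorphic_map_def)
  have "homeomorphic_map (subtopology (arboreal E) (arboreal_piece E \<alpha>)) (top_of_set (hyp \<alpha>)) (fst \<circ> \<phi>)" for \<alpha>
  proof -
    have fst\<phi>: "fst (\<phi> (arb_class E (\<alpha>, x))) = emb \<alpha> x" if "x \<in> arb_copy \<alpha>" for x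
      using that \<phi>(2) by (simp add: topspace_arb_disjoint_union \<Psi>_def)
    have "homeomorphic_maps (subtopology (arboreal E) (arboreal_piece E \<alpha>)) (top_of_set (hyp \<alpha>))
        (fst \<circ> \<phi>) (\<lambda>X. arb_class E (\<alpha>, unembed \<alpha> X))"
      unfolding homeomorphic_maps_def
    proof (intro conjI ballI)
      have "continuous_map (arboreal E) euclidean (fst \<circ> \<phi>)"
        using continuous_map_compose[OF \<phi>(1) continuous_map_from_subtopology[OF continuous_map_fst_PstarM]] .
      moreover have "(fst \<circ> \<phi>) c \<in> hyp \<alpha>" if "c \<in> arboreal_piece E \<alpha>" for c
        using that fst\<phi> h_embed by (auto simp: arboreal_piece_def)
      ultimately show "continuous_map (subtopology (arboreal E) (arboreal_piece E \<alpha>)) (top_of_set (hyp \<alpha>)) (fst \<circ> \<phi>)"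
        by (auto simp: continuous_map_in_subtopology intro: continuous_map_from_subtopology)
      have "continuous_map (top_of_set (hyp \<alpha>)) (top_of_set (arb_copy \<alpha>)) (unembed \<alpha>)"
        using continuous_unembed unembed_in_copy by auto
      moreover have "continuous_map (top_of_set (arb_copy \<alpha>)) arb_disjoint_union (\<lambda>x. (\<alpha>, x))"
        unfolding arb_disjoint_union_def by (rule continuous_map_component_injection) simp
      ultimately have "continuous_map (top_of_set (hyp \<alpha>)) (arboreal E) (arb_class E \<circ> ((\<lambda>x. (\<alpha>, x)) \<circ> unembed \<alpha>))"
        by (intro continuous_map_compose[OF _ quotient_imp_continuous_map[OF q]] continuous_map_compose)
      then show "continuous_map (top_of_set (hyp \<alpha>)) (subtopology (arboreal E) (arboreal_piece E \<alpha>))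
          (\<lambda>X. arb_class E (\<alpha>, unembed \<alpha> X))"
        using unembed_in_copy by (auto simp: continuous_map_in_subtopology o_def arboreal_piece_def)
    next
      fix c assume "c \<in> topspace (subtopology (arboreal E) (arboreal_piece E \<alpha>))"
      then obtain x where "x \<in> arb_copy \<alpha>" "c = arb_class E (\<alpha>, x)" by (auto simp: arboreal_piece_def)
      then show "arb_class E (\<alpha>, unembed \<alpha> ((fst \<circ> \<phi>) c)) = c" by (simp add: fst\<phi> unembed_embed)
    next
      fix X assume "X \<in> topspace (top_of_set (hyp \<alpha>))"
      then show "(fst \<circ> \<phi>) (arb_class E (\<alpha>, unembed \<alpha> X)) = X"
        by (simp add: fst\<phi> unembed_in_copy embed_unembed)
    qed
    then show ?thesis using homeomorphic_map_maps by blast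
  qed
  then show ?thesis using hom by blast
qed

end

theorem theorem3p20:
  fixes E :: "('v::finite) set set" and \<rho> :: 'v
    and b b' :: "real \<Rightarrow> real"
    and f :: "real \<times> real \<Rightarrow> real" and f1 f2 :: "real \<times> real \<Rightarrow> real"
    and h :: "'v \<Rightarrow> real^'v \<Rightarrow> real"
  assumes tree: "is_tree E"
    and b_C1: "\<forall>t>0. (b has_real_derivative b' t) (at t)" "continuous_on {0<..} b'"
    and b_nonpos: "\<forall>t>0. b t \<le> 0"
    and b_lim: "(b \<longlongrightarrow> 0) (at_right 0)"
    and b'_lim: "filterlim b' at_bot (at_right 0)"
    and b_eventually_zero: "\<exists>T. \<forall>t\<ge>T. b t = 0"
    and f_C1: "continuous_on UNIV f1" "continuous_on UNIV f2"
      "\<forall>p. (f has_derivative (\<lambda>(u, v). f1 p * u + f2 p * v)) (at p)"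
    and f_submersion: "\<forall>p. (f1 p, f2 p) \<noteq> (0, 0)"
    and f_zero: "\<forall>x1 x2. f (x1, x2) = 0 \<longleftrightarrow> (x1 = 0 \<and> x2 \<ge> 0) \<or> (x1 > 0 \<and> x2 = b x1)"
    and f_pos: "\<forall>x1 x2. f (x1, x2) > 0 \<longleftrightarrow> x1 > 0 \<and> x2 > b x1"
    and f_neg: "\<forall>x1 x2. f (x1, x2) < 0 \<longleftrightarrow> x1 < 0 \<or> (x1 = 0 \<and> x2 < 0) \<or> (x1 > 0 \<and> x2 < b x1)"
    and h_root: "\<forall>x. h \<rho> x = x $ \<rho>"
    and h_step: "\<forall>\<alpha> p x. is_parent E \<rho> p \<alpha> \<longrightarrow> h \<alpha> x = f (h p x, x $ \<alpha>)"
  shows "(\<exists>\<sigma>. coorientation (\<Union>\<alpha>. {x. h \<alpha> x = 0}) \<sigma> \<and>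
            (\<forall>\<alpha>. coline_bundle {x. h \<alpha> x = 0} \<subseteq> coline_bundle (\<Union>\<alpha>. {x. h \<alpha> x = 0}) \<and>
               (\<forall>p \<in> coline_bundle {x. h \<alpha> x = 0}. \<forall>\<xi>.
                  (h \<alpha> has_derivative (\<lambda>v. \<xi> \<bullet> v)) (at (fst p)) \<longrightarrow> \<sigma> p = (fst p, ray_of \<xi>))))
       \<and> (\<exists>\<phi>. homeomorphic_map (arboreal E)
                 (subtopology PstarM (coline_bundle (\<Union>\<alpha>. {x. h \<alpha> x = 0}))) \<phi> \<and>
            (\<forall>\<alpha>. homeomorphic_map (subtopology (arboreal E) (arboreal_piece E \<alpha>))
                    (top_of_set {x. h \<alpha> x = 0}) (fst \<circ> \<phi>)))"
proof -
  obtain par P where rt: "rooted_tree \<rho> par P" and E: "E = {{\<alpha>, par \<alpha>} | \<alpha>. \<alpha> \<noteq> \<rho>}"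
    and parent: "\<And>\<alpha>. \<alpha> \<noteq> \<rho> \<Longrightarrow> is_parent E \<rho> (par \<alpha>) \<alpha>"
    using tree_imp_rooted_tree[OF tree, of \<rho>] by blast
  interpret smoothed_tree \<rho> par P b b' f f1 f2 h
    using rt b_C1(1) b_nonpos b_lim f_C1 f_submersion f_zero f_pos h_root h_step parent
    unfolding smoothed_tree_def smoothed_tree_axioms_def by blast
  have "coline_bundle (hyp \<alpha>) \<subseteq> coline_bundle (\<Union>\<alpha>. hyp \<alpha>)" for \<alpha>
    unfolding coline_bundle_union coline_bundle_hyp by blast
  \<comment> \<open>Any covector representing the derivative of \<open>h \<alpha>\<close> is
    \<open>G \<alpha>\<close>, so its ray is the codirection towards
    \<open>{h \<alpha> \<ge> 0}\<close>.\<close>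
  moreover have "\<sigma> p = (fst p, ray_of \<xi>)"
    if "p \<in> coline_bundle (hyp \<alpha>)" "(h \<alpha> has_derivative (\<lambda>v. \<xi> \<bullet> v)) (at (fst p))" for p \<alpha> \<xi>
    using that(1) \<sigma>_line gradient_unique[OF that(2)] unfolding coline_bundle_hyp by auto
  ultimately show ?thesis using coorientation_\<sigma> arboreal_homeomorphism[OF E] by blast
qed

end
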